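(* There is a constant $A$, not depending on $p$ and $r$, such that for all $0<p<1$ and $p<r<\infty$ and all sequences $\{f_k\}$ of functions in $L^{p,r}$, $$\Big\|\sum_kf_k\Big\|_{p,r}\le C(p,r)\Big(\sum_k\|f_k\|_{p,r}^p\Big)^{1/p},$$ where $$C(p,r)\le A^{1/p}\Big(\frac1{1-p}\Big)^{1/p-1/r}\Big(1+\frac pr\log\frac1{1-p}\Big)^{1/p-1/r}.$$
   Context: $(X,\mu)$ is a non-atomic measure space (every set of positive measure has a subset of smaller positive measure). For a measurable function $f$ on $X$, $\mu_f(\alpha)=\mu(\{x:|f(x)|>\alpha\})$ and $f^*(t)=\inf\{\alpha:\mu_f(\alpha)\le t\}$. For $0<p,r<\infty$ the quasi-norm on the Lorentz space $L^{p,r}$ is $$\|f\|_{p,r}=\Big(\frac rp\int_0^\infty[t^{1/p}f^*(t)]^r\frac{dt}t\Big)^{1/r}=\Big(r\int_0^\infty[\mu_f(\alpha)^{1/p}\alpha]^r\frac{d\alpha}{\alpha}\Big)^{1/r}.$$ *)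

theory Defs
  imports "HOL-Analysis.Analysis"
begin

definition nonatomic :: "'a measure \<Rightarrow> bool" where
  "nonatomic M \<longleftrightarrow>
     (\<forall>S\<in>sets M. 0 < emeasure M S \<longrightarrow>
        (\<exists>T\<in>sets M. T \<subseteq> S \<and> 0 < emeasure M T \<and> emeasure M T < emeasure M S))"

text \<open>Real powers on \<open>[0,\<infinity>]\<close>; only positive exponents are used, so \<open>0\<close> and \<open>\<infinity>\<close> are fixed.\<close>

definition ennpowr :: "ennreal \<Rightarrow> real \<Rightarrow> ennreal" where
  "ennpowr x a = (if x = \<infinity> then \<infinity> else ennreal (enn2real x powr a))"

definition distribution_fun :: "'a measure \<Rightarrow> ('a \<Rightarrow> complex) \<Rightarrow> real \<Rightarrow> ennreal" where
  "distribution_fun M f \<alpha> = emeasure M {x \<in> space M. \<alpha> < norm (f x)}"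

text \<open>The infimum is taken in \<open>[0,\<infinity>]\<close>, so that it is \<open>\<infinity>\<close> over the empty set.\<close>

definition decreasing_rearrangement :: "'a measure \<Rightarrow> ('a \<Rightarrow> complex) \<Rightarrow> real \<Rightarrow> ennreal" where
  "decreasing_rearrangement M f t =
     Inf {ennreal \<alpha> | \<alpha>. 0 \<le> \<alpha> \<and> distribution_fun M f \<alpha> \<le> ennreal t}"

definition lorentz_norm :: "'a measure \<Rightarrow> real \<Rightarrow> real \<Rightarrow> ('a \<Rightarrow> complex) \<Rightarrow> ennreal" where
  "lorentz_norm M p r f =
     ennpowr (ennreal (r / p) *
       (\<integral>\<^sup>+t\<in>{0<..}. ennpowr (ennreal (t powr (1 / p)) * decreasing_rearrangement M f t) r
                      / ennreal t \<partial>lborel))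
     (1 / r)"

definition lorentz_space :: "'a measure \<Rightarrow> real \<Rightarrow> real \<Rightarrow> ('a \<Rightarrow> complex) set" where
  "lorentz_space M p r = {f \<in> borel_measurable M. lorentz_norm M p r f < \<infinity>}"

end

(* Put q = r/p > 1. Let v_k = |f_k|, let D be the sum of the distribution functions of the v_k
   and G the sum of the v_k. Up to normalisation, the p-th power of the quasi-norm is the L^q norm of
   s^p times the distribution function with respect to ds/s, so Minkowski's inequality reduces the
   claim to comparing g(s) = s^p D(s) with h(s) = s^p mu(G > s). For a level l, split each v_k
   according to the values where g exceeds a multiple of (1-p) l. The part on the low values
   satisfies a weak-type bound and contributes at most l to h; for the part on the high values,
   the p-triangle inequality bounds the ds/s-integral of the excess of h over l by a multiple of the
   integral of g over {g > (1-p) l / 8}. Integrating against l^(q-2) dl gives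
   C(p,r) = 16^(1/p) (1/(1-p))^(1/p-1/r), without the logarithmic factor. *)

theory Submission
  imports Defs
begin

section \<open>Powers on the extended nonnegative reals\<close>

text \<open>The missing logarithm is explained by where the loss 1/(1-p) is paid. Adding up
  functions that satisfy a joint weak-type bound costs this factor; paid as a factor in front of g,
  it would enter with the power q. Here it only lowers the threshold on g: the low values are
  absorbed by the level l, and the excess is charged to g with an absolute constant. The final
  integral of d(l^(q-1)) over l < 8 g / (1-p) then carries the loss with exponent q-1, and the r-th
  root turns this into 1/p - 1/r. As r tends to p only 16^(1/p) remains, in accordance with the
  p-triangle inequality in L^p.

  The cut follows g, which is not monotone, so the low values need not form an interval and neither
  estimate may assume it.

  The 16 is 2 * 8: a factor 2^q comes from the crude recovery of h^q from its excesses, and 8 *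
  8^(q-1) from the constant of the excess estimate and from the 8 in the threshold.\<close>

lemma ennpowr_ennreal: "0 \<le> x \<Longrightarrow> ennpowr (ennreal x) a = ennreal (x powr a)"
  by (simp add: ennpowr_def)

lemma ennpowr_top [simp]: "ennpowr \<infinity> a = \<infinity>" "ennpowr top a = top"
  by (simp_all add: ennpowr_def)

lemma ennpowr_0 [simp]: "ennpowr 0 a = 0"
  by (simp add: ennpowr_def)

lemma ennpowr_of_1 [simp]: "ennpowr 1 a = 1"
  using ennpowr_ennreal[of 1 a] by simp

lemma ennpowr_one [simp]: "ennpowr x 1 = x"
  by (cases x) (auto simp: ennpowr_def)

lemma ennpowr_eq_top_iff [simp]: "ennpowr x a = top \<longleftrightarrow> x = top"
  by (simp add: ennpowr_def)

lemma ennpowr_mono: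
  assumes "x \<le> y" "0 \<le> a"
  shows "ennpowr x a \<le> ennpowr y a"
proof (cases "y = top")
  case False
  then have "x < top" "y < top"
    using assms(1) by (auto simp: less_top[symmetric] top_unique)
  then show ?thesis
    using assms by (auto simp: ennpowr_def intro!: ennreal_leI powr_mono2 enn2real_mono)
qed simp

lemma ennpowr_mult:
  assumes "0 < a"
  shows "ennpowr (x * y) a = ennpowr x a * ennpowr y a"
proof -
  consider "x = 0 \<or> y = 0" | "x \<noteq> 0" "y \<noteq> 0" "x = top \<or> y = top" | "x \<noteq> top" "y \<noteq> top"
    by blast
  then show ?thesis
  proof cases
    case 2
    then have "ennpowr x a \<noteq> 0" "ennpowr y a \<noteq> 0"
      by (auto simp: ennpowr_def enn2real_eq_0_iff)
    then show ?thesis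
      using 2 by (auto simp: ennreal_mult_top ennreal_top_mult)
  next
    case 3
    then show ?thesis
      by (auto simp: ennpowr_def ennreal_mult_eq_top_iff enn2real_mult powr_mult ennreal_mult)
  qed auto
qed

lemma ennpowr_ennpowr: "ennpowr (ennpowr x a) b = ennpowr x (a * b)"
  by (cases x) (auto simp: ennpowr_ennreal powr_powr)

lemma ennpowr_add: "ennpowr x a * ennpowr x b = ennpowr x (a + b)"
  by (cases x) (auto simp: ennpowr_ennreal powr_add ennreal_mult)

lemma measurable_ennpowr [measurable (raw)]:
  assumes [measurable]: "f \<in> borel_measurable M"
  shows "(\<lambda>x. ennpowr (f x) a) \<in> borel_measurable M"
  unfolding ennpowr_def infinity_ennreal_def by measurable

text \<open>After division by the sum \<open>s = a + b\<close> both terms lie in [0,1], where t <=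
  t^p.\<close>

lemma ennpowr_add_le:
  assumes "0 < p" "p \<le> 1"
  shows "ennpowr (x + y) p \<le> ennpowr x p + ennpowr y p"
proof (cases "x = top \<or> y = top")
  case False
  then obtain a b where ab: "0 \<le> a" "0 \<le> b" "x = ennreal a" "y = ennreal b"
    by (metis ennreal_cases infinity_ennreal_def)
  have *: "(a + b) powr p \<le> a powr p + b powr p"
  proof (cases "a + b = 0")
    case False
    define s where "s = a + b"
    have s: "0 < s" using False ab s_def by simp
    have le: "c / s \<le> (c / s) powr p" if "0 \<le> c" "c \<le> s" for c
      using powr_mono'[of p 1 "c/s"] that s assms by (cases "c = 0") auto
    have "1 = a / s + b / s"
      using s by (simp add: s_def flip: add_divide_distrib)
    also have "\<dots> \<le> (a / s) powr p + (b / s) powr p"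
      by (intro add_mono le) (use ab s_def in auto)
    also have "\<dots> = (a powr p + b powr p) / s powr p"
      using ab s by (simp add: powr_divide add_divide_distrib)
    finally show ?thesis
      using s by (simp add: field_simps s_def)
  qed (use ab in auto)
  show ?thesis
    using * ab by (simp add: ennpowr_ennreal flip: ennreal_plus)
qed auto

lemma ennpowr_sum_le:
  assumes "0 < p" "p \<le> 1" "finite I"
  shows "ennpowr (\<Sum>i\<in>I. f i) p \<le> (\<Sum>i\<in>I. ennpowr (f i) p)"
  using assms(3)
proof induction
  case (insert i I)
  then show ?case
    using ennpowr_add_le[OF assms(1,2), of "f i" "sum f I"]
    by (simp add: order_trans[OF _ add_left_mono])
qed simp

text \<open>Applying the inverse power to the bound for the partial sums replaces a continuity
  argument for \<open>ennpowr\<close> at infinity.\<close>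

lemma ennpowr_suminf_le_SUP:
  assumes "0 < q"
  shows "ennpowr (\<Sum>k. y k) q \<le> (SUP n. ennpowr (\<Sum>k<n. y k) q)"
proof -
  let ?B = "SUP n. ennpowr (\<Sum>k<n. y k) q"
  have "(\<Sum>k<n. y k) \<le> ennpowr ?B (1 / q)" for n
  proof -
    have "(\<Sum>k<n. y k) = ennpowr (ennpowr (\<Sum>k<n. y k) q) (1 / q)"
      using assms by (simp add: ennpowr_ennpowr)
    also have "\<dots> \<le> ennpowr ?B (1 / q)"
      using assms by (intro ennpowr_mono SUP_upper) auto
    finally show ?thesis .
  qed
  then have "(\<Sum>k. y k) \<le> ennpowr ?B (1 / q)"
    by (auto simp: suminf_eq_SUP intro: SUP_least)
  then have "ennpowr (\<Sum>k. y k) q \<le> ennpowr (ennpowr ?B (1 / q)) q"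
    using assms by (intro ennpowr_mono) auto
  then show ?thesis
    using assms by (simp add: ennpowr_ennpowr)
qed

lemma ennpowr_suminf_le:
  assumes "0 < p" "p \<le> 1"
  shows "ennpowr (\<Sum>k. y k) p \<le> (\<Sum>k. ennpowr (y k) p)"
  by (rule order_trans[OF ennpowr_suminf_le_SUP[OF assms(1)]])
    (auto intro!: SUP_least order_trans[OF ennpowr_sum_le[OF assms]] sum_le_suminf)

text \<open>The integral of d(s^a) up to \<open>X\<close>, infinite \<open>X\<close> included. It
  serves with exponents p, q, r, q-1 and 1-p, and turns powers into layer-cake integrals
  throughout.\<close>

lemma nn_integral_power_weight:
  assumes "0 < a"
  shows "(\<integral>\<^sup>+s\<in>{0<..}. ennreal (a * s powr (a - 1)) * indicator {s. ennreal s < X} s \<partial>lborel)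
    = ennpowr X a"
proof -
  have fin: "(\<integral>\<^sup>+s\<in>{0<..}. ennreal (a * s powr (a - 1)) * indicator {s. ennreal s < ennreal x} s \<partial>lborel)
    = ennreal (x powr a)" if "0 \<le> x" for x
  proof -
    have "((\<lambda>s. s powr (a - 1)) has_integral (x powr a / a)) {0..x}"
      using has_integral_powr_from_0[of "a - 1" x] assms that by simp
    from has_integral_mult_right[OF this, of a]
    have "((\<lambda>s. a * s powr (a - 1)) has_integral x powr a) {0..x}"
      using assms by simp
    then have *: "(\<integral>\<^sup>+s. ennreal (indicator {0..x} s * (a * s powr (a - 1))) \<partial>lborel) = ennreal (x powr a)"
      by (intro nn_integral_has_integral_lebesgue) (use assms in auto)
    have "(\<integral>\<^sup>+s. ennreal (indicator {0..x} s * (a * s powr (a - 1))) \<partial>lborel)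
      = (\<integral>\<^sup>+s\<in>{0<..}. ennreal (a * s powr (a - 1)) * indicator {s. ennreal s < ennreal x} s \<partial>lborel)"
    proof (rule nn_integral_cong_AE)
      have "AE s in lborel. s \<noteq> x"
        by (rule AE_lborel_singleton)
      moreover have "AE s in lborel. s \<noteq> (0::real)"
        by (rule AE_lborel_singleton)
      ultimately show "AE s in lborel. ennreal (indicator {0..x} s * (a * s powr (a - 1)))
        = ennreal (a * s powr (a - 1)) * indicator {s. ennreal s < ennreal x} s * indicator {0<..} s"
        by eventually_elim (auto simp: indicator_def ennreal_less_iff)
    qed
    then show ?thesis
      using * by simp
  qed
  show ?thesis
  proof (cases X)
    case (real x)
    then show ?thesis using fin[of x] by (simp add: ennpowr_ennreal)
  next
    case top
    let ?I = "\<integral>\<^sup>+s\<in>{0<..}. ennreal (a * s powr (a - 1)) * indicator {s. ennreal s < X} s \<partial>lborel"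
    have le: "ennreal y \<le> ?I" if "0 < y" for y
    proof -
      have "ennreal y = ennreal ((y powr (1/a)) powr a)"
        using assms that by (simp add: powr_powr)
      also have "\<dots> = (\<integral>\<^sup>+s\<in>{0<..}. ennreal (a * s powr (a - 1)) *
            indicator {s. ennreal s < ennreal (y powr (1/a))} s \<partial>lborel)"
        by (rule fin[symmetric]) simp
      also have "\<dots> \<le> ?I"
        by (rule nn_integral_mono) (auto simp: indicator_def top)
      finally show ?thesis .
    qed
    have "?I = top"
    proof (rule ccontr)
      assume "?I \<noteq> top"
      then obtain z where z: "0 \<le> z" "?I = ennreal z"
        by (cases ?I) auto
      from z(1) have "ennreal (z + 1) \<le> ennreal z"
        unfolding z(2)[symmetric] by (intro le) simp
      with z(1) show False
        by simp
    qed
    then show ?thesis using top by simp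
  qed
qed

section \<open>Distribution functions\<close>

lemma borel_measurable_antimono_ennreal:
  fixes D :: "real \<Rightarrow> ennreal"
  assumes "antimono D"
  shows "D \<in> borel_measurable borel"
proof (rule borel_measurableI_greater)
  fix y
  have "is_interval {x. y < D x}"
    unfolding is_interval_1 using antimonoD[OF assms] by (auto intro: less_le_trans)
  then show "{x \<in> space borel. y < D x} \<in> sets borel"
    using real_interval_borel_measurable by simp
qed

text \<open>Extended values of \<open>u\<close> are allowed because the sum of the moduli may be
  infinite at some points.\<close>

definition dist_fun :: "'a measure \<Rightarrow> ('a \<Rightarrow> ennreal) \<Rightarrow> real \<Rightarrow> ennreal" where
  "dist_fun M u s = emeasure M {x \<in> space M. ennreal s < u x}"

lemma dist_fun_mono:
  assumes [measurable]: "v \<in> borel_measurable M" and "\<And>x. x \<in> space M \<Longrightarrow> u x \<le> v x"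
  shows "dist_fun M u s \<le> dist_fun M v s"
  unfolding dist_fun_def using assms(2) by (intro emeasure_mono) (auto intro: less_le_trans)

lemma antimono_dist_fun:
  assumes [measurable]: "u \<in> borel_measurable M"
  shows "antimono (dist_fun M u)"
  unfolding dist_fun_def
  by (intro antimonoI emeasure_mono) (auto intro: le_less_trans ennreal_leI)

lemma measurable_dist_fun [measurable (raw)]:
  "u \<in> borel_measurable M \<Longrightarrow> dist_fun M u \<in> borel_measurable borel"
  by (intro borel_measurable_antimono_ennreal antimono_dist_fun)

lemma distribution_fun_eq_dist_fun:
  "0 \<le> s \<Longrightarrow> distribution_fun M f s = dist_fun M (\<lambda>x. ennreal (norm (f x))) s"
  by (simp add: distribution_fun_def dist_fun_def ennreal_less_iff)

text \<open>Tonelli on the region under the graph of \<open>u\<close>. This is where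
  sigma-finiteness of \<open>M\<close> enters.\<close>

lemma nn_integral_layer_cake:
  assumes "sigma_finite_measure M" and [measurable]: "u \<in> borel_measurable M" "w \<in> borel_measurable borel"
  shows "(\<integral>\<^sup>+x. (\<integral>\<^sup>+s. w s * indicator {s. ennreal s < u x} s \<partial>lborel) \<partial>M)
    = (\<integral>\<^sup>+s. w s * dist_fun M u s \<partial>lborel)"
proof -
  interpret sigma_finite_measure M by fact
  interpret pair_sigma_finite lborel M ..
  have "(\<integral>\<^sup>+x. (\<integral>\<^sup>+s. w s * indicator {s. ennreal s < u x} s \<partial>lborel) \<partial>M)
    = (\<integral>\<^sup>+s. (\<integral>\<^sup>+x. w s * indicator {x \<in> space M. ennreal s < u x} x \<partial>M) \<partial>lborel)"
    by (subst Fubini') (auto intro!: nn_integral_cong simp: indicator_def)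
  also have "\<dots> = (\<integral>\<^sup>+s. w s * dist_fun M u s \<partial>lborel)"
    by (intro nn_integral_cong) (simp add: nn_integral_cmult_indicator dist_fun_def)
  finally show ?thesis .
qed

text \<open>With q = r/p this is the integral of (s^p D(s))^q ds/s, the second form of the
  quasi-norm without its factor r and the r-th root. It takes \<open>D\<close> rather than a
  function on the space because it is also applied to a sum of distribution functions, which may
  exceed the measure of the whole space.\<close>

definition lorentz_integral :: "real \<Rightarrow> real \<Rightarrow> (real \<Rightarrow> ennreal) \<Rightarrow> ennreal" where
  "lorentz_integral p q D =
     (\<integral>\<^sup>+s\<in>{0<..}. ennreal (s powr (p * q - 1)) * ennpowr (D s) q \<partial>lborel)"

lemma lorentz_integral_mono:
  "0 \<le> q \<Longrightarrow> (\<And>s. 0 < s \<Longrightarrow> D s \<le> D' s) \<Longrightarrow> lorentz_integral p q D \<le> lorentz_integral p q D'"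
  unfolding lorentz_integral_def
  by (intro nn_integral_mono) (auto simp: indicator_def intro!: mult_left_mono ennpowr_mono)

text \<open>Both forms of the quasi-norm integrate d(t^q) d(s^r) over the region t < D(s):
  integrating in s first gives R(t)^r, integrating in t first gives D(s)^q.\<close>

lemma lorentz_norm_eq:
  assumes "0 < p" "0 < r" and [measurable]: "f \<in> borel_measurable M"
  shows "lorentz_norm M p r f =
    ennpowr (ennreal r * lorentz_integral p (r / p) (dist_fun M (\<lambda>x. ennreal (norm (f x))))) (1 / r)"
proof -
  define q where "q = r / p"
  define D where "D = dist_fun M (\<lambda>x. ennreal (norm (f x)))"
  define R where "R = decreasing_rearrangement M f"
  have q: "0 < q" using assms q_def by simp
  have [measurable]: "D \<in> borel_measurable borel" unfolding D_def by measurable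
  have R: "R t = Inf {ennreal s | s. 0 \<le> s \<and> D s \<le> ennreal t}" for t
    unfolding R_def decreasing_rearrangement_def D_def
    by (intro arg_cong[where f=Inf] Collect_cong) (auto simp: distribution_fun_eq_dist_fun)
  have "antimono R"
    unfolding R by (intro antimonoI Inf_superset_mono) (blast intro: order_trans ennreal_leI)
  then have [measurable]: "R \<in> borel_measurable borel"
    by (rule borel_measurable_antimono_ennreal)
  have anti: "antimono D" unfolding D_def by (rule antimono_dist_fun) measurable
  \<comment> \<open>\<open>less\<close> and \<open>le\<close> show that s < R(t) and t < D(s) can
    differ only at s = R(t), a single point and hence a null set for each t. No right-continuity of
    \<open>D\<close> is needed.\<close>
  have less: "ennreal t < D s" if "ennreal s < R t" "0 < s" for s t
    using that unfolding R by (force simp: not_le[symmetric] intro!: Inf_lower)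
  have le: "ennreal s \<le> R t" if "ennreal t < D s" for s t
  proof -
    have "s \<le> s'" if "D s' \<le> ennreal t" for s'
      using that \<open>ennreal t < D s\<close> antimonoD[OF anti, of s' s] by (metis leD le_cases order_trans)
    then show ?thesis unfolding R by (auto intro!: Inf_greatest ennreal_leI)
  qed
  have power: "ennpowr (R t) r =
      (\<integral>\<^sup>+s\<in>{0<..}. ennreal (r * s powr (r - 1)) * indicator {s. ennreal t < D s} s \<partial>lborel)" for t
    unfolding nn_integral_power_weight[OF assms(2), of "R t", symmetric]
  proof (rule nn_integral_cong_AE)
    have "AE s in lborel. s \<noteq> enn2real (R t)"
      by (rule AE_lborel_singleton)
    then show "AE s in lborel. ennreal (r * s powr (r - 1)) * indicator {s. ennreal s < R t} s * indicator {0<..} s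
       = ennreal (r * s powr (r - 1)) * indicator {s. ennreal t < D s} s * indicator {0<..} s"
    proof eventually_elim
      case (elim s)
      have "ennreal s \<noteq> R t" if "0 < s"
        using elim that by (metis enn2real_ennreal less_imp_le)
      then have "ennreal s < R t \<longleftrightarrow> ennreal t < D s" if "0 < s"
        using less[OF _ that] le that by (blast intro: order.not_eq_order_implies_strict)
      then show ?case
        by (simp only: indicator_def mem_Collect_eq greaterThan_iff) (cases "0 < s", simp_all)
    qed
  qed
  have "ennreal q * (\<integral>\<^sup>+t\<in>{0<..}. ennpowr (ennreal (t powr (1 / p)) * R t) r / ennreal t \<partial>lborel)
    = (\<integral>\<^sup>+t\<in>{0<..}. ennreal (q * t powr (q - 1)) * ennpowr (R t) r \<partial>lborel)"
  proof (subst nn_integral_cmult[symmetric], measurable, rule nn_integral_cong)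
    fix t :: real
    show "ennreal q * (ennpowr (ennreal (t powr (1 / p)) * R t) r / ennreal t * indicator {0<..} t)
      = ennreal (q * t powr (q - 1)) * ennpowr (R t) r * indicator {0<..} t"
    proof (cases "0 < t")
      case True
      have "ennpowr (ennreal (t powr (1 / p)) * R t) r / ennreal t
        = (ennreal (t powr q) * ennreal (1 / t)) * ennpowr (R t) r"
        using True assms by (simp add: ennpowr_mult ennpowr_ennreal powr_powr q_def
            divide_ennreal_def inverse_ennreal mult_ac divide_inverse)
      also have "ennreal (t powr q) * ennreal (1 / t) = ennreal (t powr (q - 1))"
        using True by (simp add: powr_diff flip: ennreal_mult)
      finally show ?thesis
        using True q by (simp add: ennreal_mult mult_ac)
    qed simp
  qed
  also have "\<dots> = (\<integral>\<^sup>+t. (\<integral>\<^sup>+s. ennreal (q * t powr (q - 1)) * indicator {0<..} t *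
      (ennreal (r * s powr (r - 1)) * indicator {s. ennreal t < D s} s * indicator {0<..} s) \<partial>lborel) \<partial>lborel)"
    unfolding power by (intro nn_integral_cong) (subst nn_integral_cmult, measurable, simp add: mult_ac)
  also have "\<dots> = (\<integral>\<^sup>+s. (\<integral>\<^sup>+t. ennreal (q * t powr (q - 1)) * indicator {0<..} t *
      (ennreal (r * s powr (r - 1)) * indicator {s. ennreal t < D s} s * indicator {0<..} s) \<partial>lborel) \<partial>lborel)"
    by (rule lborel_pair.Fubini') measurable
  also have "\<dots> = (\<integral>\<^sup>+s. ennreal (r * s powr (r - 1)) * indicator {0<..} s *
      (\<integral>\<^sup>+t\<in>{0<..}. ennreal (q * t powr (q - 1)) * indicator {t. ennreal t < D s} t \<partial>lborel) \<partial>lborel)"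
    by (intro nn_integral_cong, subst nn_integral_cmult[symmetric], measurable)
      (auto intro!: nn_integral_cong simp: indicator_def mult_ac)
  also have "\<dots> = ennreal r * (\<integral>\<^sup>+s\<in>{0<..}. ennreal (s powr (r - 1)) * ennpowr (D s) q \<partial>lborel)"
    unfolding nn_integral_power_weight[OF q] using assms(2)
    by (subst nn_integral_cmult[symmetric], measurable)
      (auto intro!: nn_integral_cong simp: ennreal_mult mult_ac)
  also have "\<dots> = ennreal r * lorentz_integral p q D"
    using assms by (simp add: lorentz_integral_def q_def)
  finally show ?thesis
    unfolding lorentz_norm_def q_def R_def D_def by (rule arg_cong)
qed

section \<open>Minkowski's inequality for countable sums\<close>

text \<open>Jensen's inequality for t^q with weights \<open>a k\<close>, obtained from Young's
  inequality applied to \<open>y k / a k\<close> and a common slope. Allowing \<open>A\<close> to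
  exceed the sum of the weights makes it usable for all partial sums with one constant.\<close>

lemma powr_sum_le_weighted:
  fixes y a :: "nat \<Rightarrow> real"
  assumes "1 < q" and a: "\<And>k. 0 < a k" and y: "\<And>k. k < n \<Longrightarrow> 0 \<le> y k"
    and A: "(\<Sum>k<n. a k) \<le> A" "0 < A"
  shows "(\<Sum>k<n. y k) powr q \<le> A powr (q - 1) * (\<Sum>k<n. a k powr (1 - q) * y k powr q)"
proof (cases "(\<Sum>k<n. y k) = 0")
  case True
  then show ?thesis using a by (simp add: sum_nonneg)
next
  case False
  define Y where "Y = (\<Sum>k<n. y k)"
  have "0 \<le> Y" unfolding Y_def using y by (intro sum_nonneg) auto
  with False have Y: "0 < Y" by (simp add: Y_def)
  \<comment> \<open>The weighted mean, at which the tangent-line form of Young's inequality is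
    sharp; after summation Y w^(q-1) = A w^q cancels q-1 of the q copies.\<close>
  define w where "w = Y / A"
  have w: "0 < w" using Y A w_def by simp
  have "q * (y k * w powr (q - 1)) \<le> a k powr (1 - q) * y k powr q + (q - 1) * w powr q * a k"
    if "k < n" for k
  proof -
    have "y k / a k * w powr (q - 1)
        \<le> (y k / a k) powr q / q + (w powr (q - 1)) powr (q / (q - 1)) / (q / (q - 1))"
      by (rule Youngs_inequality) (use assms that a y in \<open>auto simp: field_simps less_imp_le\<close>)
    also have "(w powr (q - 1)) powr (q / (q - 1)) = w powr q"
      using assms(1) by (simp add: powr_powr)
    finally have "a k * q * (y k / a k * w powr (q - 1))
        \<le> a k * q * ((y k / a k) powr q / q + w powr q / (q / (q - 1)))"
      using a[of k] assms(1) by (intro mult_left_mono) auto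
    also have "\<dots> = a k * (y k / a k) powr q + (q - 1) * w powr q * a k"
      using assms(1) by (simp add: field_simps)
    also have "a k * (y k / a k) powr q = a k powr (1 - q) * y k powr q"
      using a[of k] y[OF that] by (simp add: powr_divide powr_diff)
    finally show ?thesis
      using a[of k] by (simp add: mult_ac)
  qed
  then have "(\<Sum>k<n. q * (y k * w powr (q - 1)))
      \<le> (\<Sum>k<n. a k powr (1 - q) * y k powr q + (q - 1) * w powr q * a k)"
    by (intro sum_mono) auto
  also have "\<dots> = (\<Sum>k<n. a k powr (1 - q) * y k powr q) + (q - 1) * w powr q * (\<Sum>k<n. a k)"
    by (simp add: sum.distrib sum_distrib_left)
  also have "\<dots> \<le> (\<Sum>k<n. a k powr (1 - q) * y k powr q) + (q - 1) * w powr q * A"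
    using assms by (intro add_left_mono mult_left_mono) auto
  finally have *: "q * (Y * w powr (q - 1))
      \<le> (\<Sum>k<n. a k powr (1 - q) * y k powr q) + (q - 1) * w powr q * A"
    by (simp add: Y_def sum_distrib_left sum_distrib_right)
  have "Y * w powr (q - 1) = A * w powr q"
    using w A Y by (simp add: powr_diff w_def)
  with * have "A * w powr q \<le> (\<Sum>k<n. a k powr (1 - q) * y k powr q)"
    by (simp add: algebra_simps)
  then have "A powr (q - 1) * (A * w powr q) \<le> A powr (q - 1) * (\<Sum>k<n. a k powr (1 - q) * y k powr q)"
    by (intro mult_left_mono) auto
  moreover have "A powr (q - 1) * (A * w powr q) = Y powr q"
    using A Y by (simp add: w_def powr_divide powr_diff)
  ultimately show ?thesis by (simp add: Y_def)
qed

lemma ennpowr_sum_le_weighted: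
  fixes y :: "nat \<Rightarrow> ennreal"
  assumes "1 < q" and a: "\<And>k. 0 < a k" and A: "(\<Sum>k<n. a k) \<le> A" "0 < A"
  shows "ennpowr (\<Sum>k<n. y k) q
    \<le> ennreal (A powr (q - 1)) * (\<Sum>k<n. ennreal (a k powr (1 - q)) * ennpowr (y k) q)"
proof (cases "\<exists>k<n. y k = top")
  case True
  then obtain k where k: "k < n" "y k = top" by blast
  have "(\<Sum>k<n. ennreal (a k powr (1 - q)) * ennpowr (y k) q) = top"
    using k a[of k] by (auto simp: ennreal_mult_top less_imp_neq[symmetric] intro!: bexI[of _ k])
  then show ?thesis using A by (simp only:) (simp add: ennreal_mult_top)
next
  case False
  define z where "z k = enn2real (y k)" for k
  have z: "y k = ennreal (z k)" "0 \<le> z k" if "k < n" for k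
    using False that by (auto simp: z_def less_top)
  have "(\<Sum>k<n. y k) = ennreal (\<Sum>k<n. z k)"
    by (subst sum_ennreal[symmetric]) (auto simp: z)
  moreover have "(\<Sum>k<n. ennreal (a k powr (1 - q)) * ennpowr (y k) q)
      = ennreal (\<Sum>k<n. a k powr (1 - q) * z k powr q)"
    by (subst sum_ennreal[symmetric]) (auto simp: z ennpowr_ennreal ennreal_mult)
  moreover have "0 \<le> (\<Sum>k<n. z k)"
    using z by (intro sum_nonneg) auto
  ultimately have "ennpowr (\<Sum>k<n. y k) q = ennreal ((\<Sum>k<n. z k) powr q)"
    and "ennreal (A powr (q - 1)) * (\<Sum>k<n. ennreal (a k powr (1 - q)) * ennpowr (y k) q)
      = ennreal (A powr (q - 1) * (\<Sum>k<n. a k powr (1 - q) * z k powr q))"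
    by (simp_all add: ennpowr_ennreal sum_nonneg ennreal_mult)
  then show ?thesis
    using powr_sum_le_weighted[of q a n z A] assms z by (simp add: ennreal_leI)
qed

text \<open>When the weights \<open>a k\<close> bound the L^q norms, each term of the weighted
  inequality integrates to at most a_k^(1-q) a_k^q = a_k, so the total is A^(q-1) A. This gives
  Minkowski's inequality without duality.\<close>

lemma nn_integral_ennpowr_suminf_le:
  assumes "1 < q" and [measurable]: "\<And>k. g k \<in> borel_measurable M"
    and a: "\<And>k. 0 < a k" and A: "\<And>n. (\<Sum>k<n. a k) \<le> A"
    and g: "\<And>k. (\<integral>\<^sup>+x. ennpowr (g k x) q \<partial>M) \<le> ennreal (a k powr q)"
  shows "(\<integral>\<^sup>+x. ennpowr (\<Sum>k. g k x) q \<partial>M) \<le> ennreal (A powr q)"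
proof -
  have "0 < A" using a[of 0] A[of 1] by simp
  have part: "(\<integral>\<^sup>+x. ennpowr (\<Sum>k<n. g k x) q \<partial>M) \<le> ennreal (A powr q)" for n
  proof -
    have "(\<integral>\<^sup>+x. ennpowr (\<Sum>k<n. g k x) q \<partial>M)
      \<le> (\<integral>\<^sup>+x. ennreal (A powr (q - 1)) * (\<Sum>k<n. ennreal (a k powr (1 - q)) * ennpowr (g k x) q) \<partial>M)"
      using assms \<open>0 < A\<close> by (intro nn_integral_mono ennpowr_sum_le_weighted) auto
    also have "\<dots> = ennreal (A powr (q - 1)) *
        (\<Sum>k<n. ennreal (a k powr (1 - q)) * (\<integral>\<^sup>+x. ennpowr (g k x) q \<partial>M))"
      by (simp add: nn_integral_cmult nn_integral_sum)
    also have "\<dots> \<le> ennreal (A powr (q - 1)) *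
        (\<Sum>k<n. ennreal (a k powr (1 - q)) * ennreal (a k powr q))"
      by (intro mult_left_mono sum_mono g) auto
    also have "\<dots> = ennreal (A powr (q - 1)) * (\<Sum>k<n. ennreal (a k))"
      using a by (simp add: less_imp_le flip: ennreal_mult powr_add)
    also have "\<dots> = ennreal (A powr (q - 1) * (\<Sum>k<n. a k))"
      using a by (simp add: less_imp_le sum_nonneg ennreal_mult)
    also have "\<dots> \<le> ennreal (A powr (q - 1) * A)"
      using A by (intro ennreal_leI mult_left_mono) auto
    also have "A powr (q - 1) * A = A powr q"
      using \<open>0 < A\<close> by (simp add: powr_diff)
    finally show ?thesis .
  qed
  have "(\<integral>\<^sup>+x. ennpowr (\<Sum>k. g k x) q \<partial>M) \<le> (\<integral>\<^sup>+x. (SUP n. ennpowr (\<Sum>k<n. g k x) q) \<partial>M)"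
    using assms(1) by (intro nn_integral_mono ennpowr_suminf_le_SUP) auto
  also have "\<dots> = (SUP n. (\<integral>\<^sup>+x. ennpowr (\<Sum>k<n. g k x) q \<partial>M))"
    using assms(1) by (intro nn_integral_monotone_convergence_SUP incseq_SucI le_funI ennpowr_mono) auto
  also have "\<dots> \<le> ennreal (A powr q)"
    by (intro SUP_least part)
  finally show ?thesis .
qed

lemma Minkowski_nn_integral_suminf:
  assumes "1 < q" and [measurable]: "\<And>k. g k \<in> borel_measurable M"
  shows "ennpowr (\<integral>\<^sup>+x. ennpowr (\<Sum>k. g k x) q \<partial>M) (1 / q)
    \<le> (\<Sum>k. ennpowr (\<integral>\<^sup>+x. ennpowr (g k x) q \<partial>M) (1 / q))" (is "?L \<le> suminf ?b")
proof (rule ennreal_le_epsilon)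
  fix e :: real
  assume fin: "suminf ?b < top" and e: "0 < e"
  have bfin: "?b k < top" for k
    using sum_le_suminf[of ?b "{k}"] fin by (simp add: le_less_trans)
  define a where "a k = enn2real (?b k) + e * (1/2) ^ Suc k" for k \<comment> \<open>positive even if \<open>?b k = 0\<close>\<close>
  define S where "S = enn2real (suminf ?b)"
  have b: "?b k = ennreal (enn2real (?b k))" for k
    using bfin by simp
  have a: "0 < a k" for k using e by (simp add: a_def add_nonneg_pos)
  have "(\<Sum>k<n. a k) \<le> S + e" for n
  proof -
    have "ennreal (\<Sum>k<n. enn2real (?b k)) = (\<Sum>k<n. ?b k)"
      using b by (simp flip: sum_ennreal)
    also have "\<dots> \<le> suminf ?b"
      by (intro sum_le_suminf) auto
    finally have "(\<Sum>k<n. enn2real (?b k)) \<le> S"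
      using fin by (simp add: S_def) (metis ennreal_le_iff enn2real_nonneg ennreal_enn2real)
    moreover have "(\<Sum>k<n. e * (1/2) ^ Suc k) \<le> e"
    proof -
      have "(\<Sum>k<n. (1/2) ^ Suc k) = 1 - (1/2::real) ^ n"
        by (induction n) auto
      then show ?thesis
        using e by (simp only: sum_distrib_left[symmetric]) simp
    qed
    ultimately show ?thesis by (simp add: a_def sum.distrib)
  qed
  moreover have "(\<integral>\<^sup>+x. ennpowr (g k x) q \<partial>M) \<le> ennreal (a k powr q)" for k
  proof -
    have "(\<integral>\<^sup>+x. ennpowr (g k x) q \<partial>M) = ennpowr (?b k) q"
      using assms(1) by (simp add: ennpowr_ennpowr)
    also have "\<dots> \<le> ennpowr (ennreal (a k)) q"
      using assms(1) e by (subst b, intro ennpowr_mono ennreal_leI) (auto simp: a_def)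
    finally show ?thesis
      using a[of k] by (simp add: ennpowr_ennreal less_imp_le)
  qed
  ultimately have "(\<integral>\<^sup>+x. ennpowr (\<Sum>k. g k x) q \<partial>M) \<le> ennreal ((S + e) powr q)"
    using assms a by (intro nn_integral_ennpowr_suminf_le[where a=a]) auto
  then have "?L \<le> ennpowr (ennreal ((S + e) powr q)) (1 / q)"
    using assms(1) by (intro ennpowr_mono) auto
  also have "\<dots> = ennreal (S + e)"
    using assms(1) e by (simp add: ennpowr_ennreal powr_powr S_def)
  also have "\<dots> = suminf ?b + ennreal e"
    using e fin by (simp add: S_def)
  finally show "?L \<le> suminf ?b + ennreal e" .
qed

lemma lorentz_integral_suminf_le:
  assumes "1 < q" and [measurable]: "\<And>k. D k \<in> borel_measurable borel"
  shows "ennpowr (lorentz_integral p q (\<lambda>s. \<Sum>k. D k s)) (1 / q)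
    \<le> (\<Sum>k. ennpowr (lorentz_integral p q (D k)) (1 / q))"
proof -
  \<comment> \<open>The exponent is chosen so that the q-th power of the weight is s^(pq-1);
    Minkowski's inequality then applies on plain Lebesgue measure.\<close>
  define w where "w s = ennreal (s powr (p - 1 / q)) * indicator {0<..} s" for s :: real
  have [measurable]: "w \<in> borel_measurable borel" unfolding w_def by measurable
  have eq: "lorentz_integral p q D' = (\<integral>\<^sup>+s. ennpowr (w s * D' s) q \<partial>lborel)" for D'
    unfolding lorentz_integral_def w_def using assms(1)
    by (intro nn_integral_cong)
      (auto simp: indicator_def ennpowr_mult ennpowr_ennreal powr_powr left_diff_distrib)
  have "ennpowr (lorentz_integral p q (\<lambda>s. \<Sum>k. D k s)) (1 / q)
      = ennpowr (\<integral>\<^sup>+s. ennpowr (\<Sum>k. w s * D k s) q \<partial>lborel) (1 / q)"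
    unfolding eq by simp
  also have "\<dots> \<le> (\<Sum>k. ennpowr (\<integral>\<^sup>+s. ennpowr (w s * D k s) q \<partial>lborel) (1 / q))"
    using assms(1) by (intro Minkowski_nn_integral_suminf) auto
  finally show ?thesis unfolding eq .
qed

section \<open>The distribution function of a sum\<close>

locale nonneg_series = sigma_finite_measure M for M :: "'a measure" +
  fixes v :: "nat \<Rightarrow> 'a \<Rightarrow> real" and p :: real
  assumes measurable_v [measurable]: "\<And>k. v k \<in> borel_measurable M"
    and v_nonneg: "\<And>k x. 0 \<le> v k x"
    and p: "0 < p" "p < 1"
begin

definition pointwise_sum :: "'a \<Rightarrow> ennreal" where "pointwise_sum x = (\<Sum>k. ennreal (v k x))"

definition dist_sum :: "real \<Rightarrow> ennreal" where "dist_sum s = (\<Sum>k. dist_fun M (\<lambda>x. ennreal (v k x)) s)"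

lemma measurable_pointwise_sum [measurable]: "pointwise_sum \<in> borel_measurable M"
  unfolding pointwise_sum_def by measurable

lemma antimono_dist_sum: "antimono dist_sum"
  unfolding dist_sum_def
  by (intro antimonoI suminf_le summableI antimonoD[OF antimono_dist_fun]) auto

lemma measurable_dist_sum [measurable]: "dist_sum \<in> borel_measurable borel"
  by (rule borel_measurable_antimono_ennreal[OF antimono_dist_sum])

text \<open>Solves c^p = 1/2, so that shrinking the argument by c costs exactly a factor 2 in
  s^p.\<close>

definition c :: real where "c = 2 powr (- (1 / p))"

lemma c: "0 < c" "c < 1" "c powr p = 1 / 2"
proof -
  show "0 < c" by (simp add: c_def)
  show "c powr p = 1 / 2"
    using p powr_powr[of 2 "- (1 / p)" p] by (simp add: c_def powr_minus)
  show "c < 1"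
    using p by (simp add: c_def powr_less_one)
qed

text \<open>Testing the bound at \<open>c * s\<close> instead of \<open>s\<close> leaves room both for a strict comparison with an
  infimum, so that no one-sided limits of \<open>dist_sum\<close> occur, and for an interval of levels below any
  value outside \<open>small \<kappa>\<close> on which the bound also fails up to a factor.\<close>

definition small :: "real \<Rightarrow> real set" where
  "small \<kappa> = {s. 0 < s \<and> ennreal (s powr p) * dist_sum (c * s) \<le> ennreal \<kappa>}"

lemma sets_small [measurable]: "small \<kappa> \<in> sets borel"
  unfolding small_def by measurable

definition small_part :: "real \<Rightarrow> nat \<Rightarrow> 'a \<Rightarrow> ennreal" where
  "small_part \<kappa> k x = ennreal (v k x) * indicator (small \<kappa>) (v k x)"

definition large_part :: "real \<Rightarrow> nat \<Rightarrow> 'a \<Rightarrow> ennreal" where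
  "large_part \<kappa> k x = ennreal (v k x) * indicator (- small \<kappa>) (v k x)"

lemma measurable_parts [measurable]:
  "small_part \<kappa> k \<in> borel_measurable M" "large_part \<kappa> k \<in> borel_measurable M"
  unfolding small_part_def large_part_def by measurable

lemma pointwise_sum_split: "pointwise_sum x = (\<Sum>k. small_part \<kappa> k x) + (\<Sum>k. large_part \<kappa> k x)"
  unfolding pointwise_sum_def small_part_def large_part_def
  by (subst suminf_add) (auto intro!: suminf_cong summableI simp: indicator_def)

text \<open>All values of the small parts above \<open>\<beta>\<close> are at least the infimum of
  the admissible values. Testing the defining bound at one value near this infimum therefore
  controls all the terms simultaneously.\<close>

lemma sum_dist_small_part_le:
  assumes "0 < \<kappa>" "0 < \<beta>"
  shows "(\<Sum>k. dist_fun M (small_part \<kappa> k) \<beta>) \<le> ennreal (\<kappa> * \<beta> powr (- p))"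
proof -
  define S where "S = small \<kappa> \<inter> {\<beta><..}"
  have in_S: "v k x \<in> S" if "ennreal \<beta> < small_part \<kappa> k x" for k x
    using that assms
    by (cases "v k x \<in> small \<kappa>") (auto simp: small_part_def S_def ennreal_less_iff)
  show ?thesis
  proof (cases "S = {}")
    case True
    then have "{x \<in> space M. ennreal \<beta> < small_part \<kappa> k x} = {}" for k
      using in_S[of k] by blast
    then have "dist_fun M (small_part \<kappa> k) \<beta> = 0" for k
      by (simp only: dist_fun_def emeasure_empty)
    then show ?thesis by simp
  next
    case False
    \<comment> \<open>The infimum need not belong to \<open>S\<close>, but some \<open>s\<close> in
      \<open>S\<close> lies below \<open>s0 / c\<close>. Then \<open>c * s < s0\<close>, so every
      value counted on the left exceeds \<open>c * s\<close> strictly and is counted in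
      \<open>dist_sum (c * s)\<close>.\<close>
    define s0 where "s0 = Inf S"
    have bdd: "bdd_below S" by (auto simp: S_def intro!: bdd_belowI[of _ \<beta>])
    have "\<beta> \<le> s0"
      unfolding s0_def using False by (intro cInf_greatest) (auto simp: S_def)
    then have "s0 < s0 / c"
      using c assms by (simp add: field_simps)
    then obtain s where s: "s \<in> S" "s < s0 / c"
      unfolding s0_def using cInf_lessD[OF False] by blast
    have cs: "c * s < s0"
      using s c by (simp add: field_simps)
    have s_pos: "0 < s" "\<beta> < s" and small: "ennreal (s powr p) * dist_sum (c * s) \<le> ennreal \<kappa>"
      using s assms by (auto simp: S_def small_def)
    have "(\<Sum>k. dist_fun M (small_part \<kappa> k) \<beta>) \<le> dist_sum (c * s)"
      unfolding dist_sum_def dist_fun_def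
    proof (intro suminf_le emeasure_mono summableI)
      fix k
      show "{x \<in> space M. ennreal \<beta> < small_part \<kappa> k x} \<subseteq> {x \<in> space M. ennreal (c * s) < ennreal (v k x)}"
      proof safe
        fix x assume "ennreal \<beta> < small_part \<kappa> k x"
        then have "s0 \<le> v k x"
          unfolding s0_def by (intro cInf_lower in_S bdd)
        then show "ennreal (c * s) < ennreal (v k x)"
          using cs c s_pos by (simp add: ennreal_less_iff)
      qed
    qed measurable
    also have "\<dots> = ennreal (s powr (- p)) * (ennreal (s powr p) * dist_sum (c * s))"
      using s_pos by (simp add: mult.assoc[symmetric] flip: ennreal_mult powr_add)
    also have "\<dots> \<le> ennreal (s powr (- p)) * ennreal \<kappa>"
      by (intro mult_left_mono small) simp
    also have "\<dots> \<le> ennreal (\<kappa> * \<beta> powr (- p))"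
      using s_pos assms p
      by (auto simp: mult.commute intro!: ennreal_leI mult_left_mono powr_mono2' simp flip: ennreal_mult)
    finally show ?thesis .
  qed
qed

text \<open>Truncation at \<open>\<beta>\<close> followed by Markov's inequality: the truncated sum
  has integral at most the integral of \<open>\<kappa>\<close> s^(-p) over
  (0,\<open>\<beta>\<close>). Here p < 1 gives convergence at 0, and the factor 1/(1-p) is
  born.\<close>

lemma dist_sum_small_part_le:
  assumes "0 < \<kappa>" "0 < \<beta>"
  shows "dist_fun M (\<lambda>x. \<Sum>k. small_part \<kappa> k x) \<beta> \<le> ennreal (\<kappa> * \<beta> powr (- p) / (1 - p))"
proof -
  let ?w = "small_part \<kappa>"
  have trunc: "(\<integral>\<^sup>+s. indicator {0<..<\<beta>} s * indicator {s. ennreal s < y} s \<partial>lborel) = min y (ennreal \<beta>)" for y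
  proof -
    have "(\<integral>\<^sup>+s. indicator {0<..<\<beta>} s * indicator {s. ennreal s < y} s \<partial>lborel)
        = (\<integral>\<^sup>+s. indicator {0<..<enn2real (min y (ennreal \<beta>))} s \<partial>lborel)"
      using assms
      by (cases y) (auto intro!: nn_integral_cong simp: indicator_def ennreal_less_iff min_def top_unique split: if_splits)
    also have "\<dots> = min y (ennreal \<beta>)"
      by (cases y) (auto simp: min_def top_unique)
    finally show ?thesis .
  qed
  have "(\<integral>\<^sup>+x. (\<Sum>k. min (?w k x) (ennreal \<beta>)) \<partial>M) = (\<Sum>k. (\<integral>\<^sup>+x. min (?w k x) (ennreal \<beta>) \<partial>M))"
    by (rule nn_integral_suminf) measurable
  also have "\<dots> = (\<Sum>k. (\<integral>\<^sup>+s. indicator {0<..<\<beta>} s * dist_fun M (?w k) s \<partial>lborel))"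
    unfolding trunc[symmetric]
    by (intro suminf_cong nn_integral_layer_cake[OF sigma_finite_measure_axioms]) measurable
  also have "\<dots> = (\<integral>\<^sup>+s. (\<Sum>k. indicator {0<..<\<beta>} s * dist_fun M (?w k) s) \<partial>lborel)"
    by (rule nn_integral_suminf[symmetric]) measurable
  also have "\<dots> \<le> (\<integral>\<^sup>+s. ennreal (\<kappa> / (1 - p)) *
      (ennreal ((1 - p) * s powr ((1 - p) - 1)) * indicator {s. ennreal s < ennreal \<beta>} s * indicator {0<..} s) \<partial>lborel)"
  proof (rule nn_integral_mono)
    fix s
    show "(\<Sum>k. indicator {0<..<\<beta>} s * dist_fun M (?w k) s) \<le> ennreal (\<kappa> / (1 - p)) *
      (ennreal ((1 - p) * s powr ((1 - p) - 1)) * indicator {s. ennreal s < ennreal \<beta>} s * indicator {0<..} s)"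
    proof (cases "0 < s \<and> s < \<beta>")
      case True
      have "ennreal (\<kappa> / (1 - p)) * ennreal ((1 - p) * s powr ((1 - p) - 1)) = ennreal (\<kappa> * s powr (- p))"
        using p assms by (simp flip: ennreal_mult)
      then show ?thesis
        using True sum_dist_small_part_le[OF assms(1), of s] by (simp add: ennreal_less_iff)
    qed (auto simp: indicator_def)
  qed
  also have "\<dots> = ennreal (\<kappa> / (1 - p)) * ennreal (\<beta> powr (1 - p))"
    using assms p nn_integral_power_weight[of "1 - p" "ennreal \<beta>"]
    by (subst nn_integral_cmult) (auto simp: ennpowr_ennreal)
  finally have int: "(\<integral>\<^sup>+x. (\<Sum>k. min (?w k x) (ennreal \<beta>)) \<partial>M)
      \<le> ennreal (\<kappa> / (1 - p)) * ennreal (\<beta> powr (1 - p))" .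
  have "dist_fun M (\<lambda>x. \<Sum>k. ?w k x) \<beta>
      \<le> emeasure M {x \<in> space M. 1 \<le> ennreal (1 / \<beta>) * (\<Sum>k. min (?w k x) (ennreal \<beta>))}"
    unfolding dist_fun_def
  proof (intro emeasure_mono)
    show "{x \<in> space M. ennreal \<beta> < (\<Sum>k. ?w k x)}
      \<subseteq> {x \<in> space M. 1 \<le> ennreal (1 / \<beta>) * (\<Sum>k. min (?w k x) (ennreal \<beta>))}"
    proof safe
      fix x assume less: "ennreal \<beta> < (\<Sum>k. ?w k x)"
      \<comment> \<open>Truncation does not lose the event: either a single term already reaches
        \<open>\<beta>\<close>, or no term is changed.\<close>
      have "ennreal \<beta> \<le> (\<Sum>k. min (?w k x) (ennreal \<beta>))"
      proof (cases "\<exists>k. ennreal \<beta> \<le> ?w k x")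
        case True
        then obtain k where "ennreal \<beta> \<le> ?w k x" by blast
        then have "min (?w k x) (ennreal \<beta>) = ennreal \<beta>" by (rule min_absorb2)
        then show ?thesis
          using sum_le_suminf[of "\<lambda>k. min (?w k x) (ennreal \<beta>)" "{k}"] by simp
      next
        case False
        then have "min (?w k x) (ennreal \<beta>) = ?w k x" for k
          by (simp add: min_def not_le less_imp_le)
        then show ?thesis using less by simp
      qed
      then have "ennreal (1 / \<beta>) * ennreal \<beta> \<le> ennreal (1 / \<beta>) * (\<Sum>k. min (?w k x) (ennreal \<beta>))"
        by (intro mult_left_mono) auto
      then show "1 \<le> ennreal (1 / \<beta>) * (\<Sum>k. min (?w k x) (ennreal \<beta>))"
        using assms by (simp flip: ennreal_mult)
    qed
  qed measurable
  also have "\<dots> \<le> ennreal (1 / \<beta>) * (\<integral>\<^sup>+x. (\<Sum>k. min (?w k x) (ennreal \<beta>)) * indicator (space M) x \<partial>M)"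
    by (rule nn_integral_Markov_inequality) measurable
  also have "(\<integral>\<^sup>+x. (\<Sum>k. min (?w k x) (ennreal \<beta>)) * indicator (space M) x \<partial>M)
      = (\<integral>\<^sup>+x. (\<Sum>k. min (?w k x) (ennreal \<beta>)) \<partial>M)"
    by (intro nn_integral_cong) simp
  also have "ennreal (1 / \<beta>) * \<dots> \<le> ennreal (1 / \<beta>) * (ennreal (\<kappa> / (1 - p)) * ennreal (\<beta> powr (1 - p)))"
    by (intro mult_left_mono int) simp
  also have "\<dots> = ennreal (\<kappa> * \<beta> powr (- p) / (1 - p))"
    using assms p by (simp add: powr_diff powr_minus field_simps flip: ennreal_mult)
  finally show ?thesis .
qed

text \<open>The density of d(s^p) on the set where g exceeds \<open>\<kappa> / 4\<close>; the 4 is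
  the room gained by two shrinkings by \<open>c\<close>.\<close>

definition large_weight :: "real \<Rightarrow> real \<Rightarrow> ennreal" where
  "large_weight \<kappa> s = ennreal (p * s powr (p - 1)) *
  indicator {s. ennreal (\<kappa> / 4) < ennreal (s powr p) * dist_sum s} s * indicator {0<..} s"

lemma measurable_large_weight [measurable]: "large_weight \<kappa> \<in> borel_measurable borel"
  unfolding large_weight_def by measurable

text \<open>A value y outside \<open>small \<kappa>\<close> forces g > \<open>\<kappa> / 4\<close>
  on the whole interval from c^2 y to c y. This interval has d(s^p)-mass y^p/2 - y^p/4 = y^p/4,
  which pays for y^p up to the factor 4.\<close>

lemma ennpowr_large_part_le:
  assumes "0 < \<kappa>"
  shows "ennpowr (large_part \<kappa> k x) p
    \<le> 4 * (\<integral>\<^sup>+s. large_weight \<kappa> s * indicator {s. ennreal s < ennreal (v k x)} s \<partial>lborel)"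
proof (cases "v k x = 0 \<or> v k x \<in> small \<kappa>")
  case True
  then show ?thesis by (auto simp: large_part_def)
next
  case False
  define y where "y = v k x"
  have y: "0 < y" using False v_nonneg[of k x] by (simp add: y_def)
  have large: "ennreal \<kappa> < ennreal (y powr p) * dist_sum (c * y)"
    using False y by (simp add: y_def small_def)
  let ?I = "\<integral>\<^sup>+s. large_weight \<kappa> s * indicator {s. ennreal s < ennreal y} s \<partial>lborel"
  let ?J = "\<lambda>b. \<integral>\<^sup>+s\<in>{0<..}. ennreal (p * s powr (p - 1)) * indicator {s. ennreal s < ennreal b} s \<partial>lborel"
  have cc: "(c * y) powr p = y powr p / 2" "(c * (c * y)) powr p = y powr p / 4"
    using c(1) y by (simp_all add: powr_mult c(3))
  have J: "?J (c * y) = ennreal (y powr p / 2)" "?J (c * (c * y)) = ennreal (y powr p / 4)"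
    using c(1) y nn_integral_power_weight[OF p(1)] by (simp_all add: ennpowr_ennreal cc)
  \<comment> \<open>On this interval s^p is at least y^p/4, while \<open>dist_sum s\<close> is at
    least \<open>dist_sum (c * y)\<close> by monotonicity.\<close>
  have big: "ennreal (\<kappa> / 4) < ennreal (s powr p) * dist_sum s" if s: "c * (c * y) \<le> s" "s < c * y" for s
  proof -
    have "ennreal (\<kappa> / 4) = ennreal (1 / 4) * ennreal \<kappa>"
      using assms by (simp flip: ennreal_mult)
    also have "\<dots> < ennreal (1 / 4) * (ennreal (y powr p) * dist_sum (c * y))"
      using large by (intro ennreal_mult_strict_left_mono) auto
    also have "\<dots> = ennreal ((c * (c * y)) powr p) * dist_sum (c * y)"
      unfolding cc(2) by (simp add: mult.assoc[symmetric] flip: ennreal_mult)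
    also have "\<dots> \<le> ennreal (s powr p) * dist_sum s"
      using s c y p by (intro mult_mono ennreal_leI powr_mono2 antimonoD[OF antimono_dist_sum]) auto
    finally show ?thesis .
  qed
  have "?J (c * y) \<le> (\<integral>\<^sup>+s. ennreal (p * s powr (p - 1)) * indicator {s. ennreal s < ennreal (c * (c * y))} s * indicator {0<..} s
      + large_weight \<kappa> s * indicator {s. ennreal s < ennreal y} s \<partial>lborel)"
  proof (rule nn_integral_mono)
    fix s
    have "c * y < y" using c y by simp
    then show "ennreal (p * s powr (p - 1)) * indicator {s. ennreal s < ennreal (c * y)} s * indicator {0<..} s
      \<le> ennreal (p * s powr (p - 1)) * indicator {s. ennreal s < ennreal (c * (c * y))} s * indicator {0<..} s
        + large_weight \<kappa> s * indicator {s. ennreal s < ennreal y} s"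
      using big[of s] by (auto simp: indicator_def large_weight_def ennreal_less_iff)
  qed
  also have "\<dots> = ?J (c * (c * y)) + ?I"
    by (rule nn_integral_add) measurable
  finally have *: "ennreal (y powr p / 2) \<le> ennreal (y powr p / 4) + ?I"
    unfolding J .
  have "ennreal (y powr p / 4) \<le> ?I"
  proof (cases ?I)
    case (real i)
    then show ?thesis using * by (simp flip: ennreal_plus)
  qed simp
  then have "4 * ennreal (y powr p / 4) \<le> 4 * ?I"
    by (intro mult_left_mono) auto
  moreover have "4 * ennreal (y powr p / 4) = ennreal (y powr p)"
    using ennreal_mult[of 4 "y powr p / 4"] by simp
  moreover have "ennpowr (large_part \<kappa> k x) p = ennreal (y powr p)"
    using False y by (simp add: large_part_def y_def ennpowr_ennreal)
  ultimately show ?thesis by (simp add: y_def)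
qed

text \<open>The left side is, up to the factor 1/p, the integral of (2 * sum)^p. The p-triangle
  inequality splits it into single terms, and the layer cake reassembles these into
  \<open>dist_sum\<close>. The 8 is the bound 2 for 2^p times the 4 of the pointwise
  estimate.\<close>

lemma nn_integral_dist_large_part_le:
  assumes "0 < \<kappa>"
  shows "(\<integral>\<^sup>+s\<in>{0<..}. ennreal (s powr (p - 1)) * dist_fun M (\<lambda>x. 2 * (\<Sum>k. large_part \<kappa> k x)) s \<partial>lborel)
    \<le> 8 * (\<integral>\<^sup>+s\<in>{0<..}. ennreal (s powr (p - 1)) * dist_sum s *
        indicator {s. ennreal (\<kappa> / 4) < ennreal (s powr p) * dist_sum s} s \<partial>lborel)" (is "?L \<le> 8 * ?R")
proof -
  let ?u = "\<lambda>x. 2 * (\<Sum>k. large_part \<kappa> k x)"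
  \<comment> \<open>Multiplying by p makes the weight d(s^p); the same p appears on the right
    through \<open>large_weight\<close> and is cancelled at the end.\<close>
  have "ennreal p * ?L = (\<integral>\<^sup>+s. (ennreal (p * s powr (p - 1)) * indicator {0<..} s) * dist_fun M ?u s \<partial>lborel)"
    using p by (subst nn_integral_cmult[symmetric]) (auto intro!: nn_integral_cong simp: ennreal_mult mult_ac)
  also have "\<dots> = (\<integral>\<^sup>+x. (\<integral>\<^sup>+s. (ennreal (p * s powr (p - 1)) * indicator {0<..} s) *
      indicator {s. ennreal s < ?u x} s \<partial>lborel) \<partial>M)"
    by (rule nn_integral_layer_cake[OF sigma_finite_measure_axioms, symmetric]) measurable
  also have "\<dots> = (\<integral>\<^sup>+x. ennpowr (?u x) p \<partial>M)"
    unfolding nn_integral_power_weight[OF p(1), symmetric]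
    by (intro nn_integral_cong) (simp add: mult_ac)
  also have "\<dots> \<le> (\<integral>\<^sup>+x. 2 * (\<Sum>k. ennpowr (large_part \<kappa> k x) p) \<partial>M)"
  proof (rule nn_integral_mono)
    fix x
    have "ennpowr (\<Sum>k. large_part \<kappa> k x) p \<le> (\<Sum>k. ennpowr (large_part \<kappa> k x) p)"
      using p by (intro ennpowr_suminf_le) auto
    moreover have "ennpowr 2 p \<le> 2"
    proof -
      have "2 powr p \<le> (2::real) powr 1"
        using p by (intro powr_mono) auto
      then show ?thesis
        using ennpowr_ennreal[of 2 p] ennreal_leI[of "2 powr p" 2] by simp
    qed
    ultimately show "ennpowr (?u x) p \<le> 2 * (\<Sum>k. ennpowr (large_part \<kappa> k x) p)"
      using p by (simp add: ennpowr_mult mult_mono)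
  qed
  also have "\<dots> \<le> (\<integral>\<^sup>+x. 2 * (\<Sum>k. 4 * (\<integral>\<^sup>+s. large_weight \<kappa> s *
      indicator {s. ennreal s < ennreal (v k x)} s \<partial>lborel)) \<partial>M)"
    using assms by (intro nn_integral_mono mult_left_mono suminf_le ennpowr_large_part_le summableI) auto
  also have "\<dots> = 2 * (\<Sum>k. 4 * (\<integral>\<^sup>+x. (\<integral>\<^sup>+s. large_weight \<kappa> s *
      indicator {s. ennreal s < ennreal (v k x)} s \<partial>lborel) \<partial>M))"
    by (simp add: nn_integral_cmult nn_integral_suminf)
  also have "\<dots> = 2 * (\<Sum>k. 4 * (\<integral>\<^sup>+s. large_weight \<kappa> s * dist_fun M (\<lambda>x. ennreal (v k x)) s \<partial>lborel))"
    by (subst nn_integral_layer_cake[OF sigma_finite_measure_axioms]) measurable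
  also have "\<dots> = 8 * (\<integral>\<^sup>+s. large_weight \<kappa> s * dist_sum s \<partial>lborel)"
    unfolding dist_sum_def
    by (simp add: nn_integral_suminf[symmetric] mult.assoc[symmetric])
  also have "(\<integral>\<^sup>+s. large_weight \<kappa> s * dist_sum s \<partial>lborel) = ennreal p * ?R"
    using p by (subst nn_integral_cmult[symmetric])
      (auto intro!: nn_integral_cong simp: large_weight_def ennreal_mult mult_ac)
  finally have "ennreal p * ?L \<le> ennreal p * (8 * ?R)"
    by (simp add: mult_ac)
  then show ?thesis
    using p by (simp add: ennreal_mult_le_mult_iff)
qed

text \<open>If the full sum exceeds s, then the small or the large parts sum to more than s/2. The
  first event contributes at most l to h, so subtracting l leaves only the second.\<close>

lemma nn_integral_excess_le:
  assumes "0 < l"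
  shows "(\<integral>\<^sup>+s\<in>{0<..}. ennreal (1 / s) * (ennreal (s powr p) * dist_fun M pointwise_sum s - ennreal l) \<partial>lborel)
    \<le> 8 * (\<integral>\<^sup>+s\<in>{0<..}. ennreal (1 / s) * (ennreal (s powr p) * dist_sum s) *
        indicator {s. ennreal l < ennreal (8 / (1 - p)) * (ennreal (s powr p) * dist_sum s)} s \<partial>lborel)"
proof -
  \<comment> \<open>Makes the small-part contribution s^p \<open>\<kappa>\<close> (s/2)^(-p) / (1-p)
    equal to (l/2) 2^p, which is at most l; then \<open>\<kappa> / 4\<close> is the threshold l
    (1-p) / 8.\<close>
  define \<kappa> where "\<kappa> = l * (1 - p) / 2"
  have \<kappa>: "0 < \<kappa>" using assms p by (simp add: \<kappa>_def)
  let ?G1 = "\<lambda>x. 2 * (\<Sum>k. large_part \<kappa> k x)"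
  let ?G2 = "\<lambda>x. \<Sum>k. small_part \<kappa> k x"
  have weight: "ennreal (1 / s) * ennreal (s powr p) = ennreal (s powr (p - 1))" if "0 < s" for s
    using that by (simp add: powr_diff flip: ennreal_mult)
  have excess: "ennreal (s powr p) * dist_fun M pointwise_sum s - ennreal l \<le> ennreal (s powr p) * dist_fun M ?G1 s"
    if s: "0 < s" for s
  proof -
    have "dist_fun M pointwise_sum s \<le> emeasure M ({x \<in> space M. ennreal s < ?G1 x} \<union> {x \<in> space M. ennreal (s / 2) < ?G2 x})"
      unfolding dist_fun_def
    proof (intro emeasure_mono subsetI; measurable?)
      fix x assume "x \<in> {x \<in> space M. ennreal s < pointwise_sum x}"
      then have x: "x \<in> space M" "ennreal s < pointwise_sum x" by auto
      have "ennreal s < ?G1 x \<or> ennreal (s / 2) < ?G2 x"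
      proof (rule ccontr)
        assume "\<not> ?thesis"
        then have le: "?G1 x \<le> ennreal s" "?G2 x \<le> ennreal (s / 2)" by (auto simp: not_less)
        have "2 * ?G2 x \<le> 2 * ennreal (s / 2)" by (intro mult_left_mono le) auto
        also have "\<dots> = ennreal s" using ennreal_mult[of 2 "s/2"] s by simp
        finally have "2 * pointwise_sum x \<le> ennreal s + ennreal s"
          unfolding pointwise_sum_split[of x \<kappa>] distrib_left using le(1) by (subst add.commute) (rule add_mono)
        also have "\<dots> = 2 * ennreal s" by (simp add: mult_2)
        finally have "pointwise_sum x \<le> ennreal s"
          by (simp add: ennreal_mult_le_mult_iff)
        with x show False by simp
      qed
      with x show "x \<in> {x \<in> space M. ennreal s < ?G1 x} \<union> {x \<in> space M. ennreal (s / 2) < ?G2 x}" by auto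
    qed
    also have "\<dots> \<le> dist_fun M ?G1 s + dist_fun M ?G2 (s / 2)"
      unfolding dist_fun_def by (intro emeasure_subadditive) measurable
    also have "\<dots> \<le> dist_fun M ?G1 s + ennreal (\<kappa> * (s / 2) powr (- p) / (1 - p))"
      using s \<kappa> by (intro add_left_mono dist_sum_small_part_le) auto
    finally have "ennreal (s powr p) * dist_fun M pointwise_sum s
        \<le> ennreal (s powr p) * (dist_fun M ?G1 s + ennreal (\<kappa> * (s / 2) powr (- p) / (1 - p)))"
      by (intro mult_left_mono) auto
    also have "\<dots> = ennreal (s powr p) * dist_fun M ?G1 s + ennreal (s powr p * (\<kappa> * (s / 2) powr (- p) / (1 - p)))"
      using \<kappa> p by (simp add: distrib_left flip: ennreal_mult)
    also have "s powr p * (\<kappa> * (s / 2) powr (- p) / (1 - p)) = l / 2 * 2 powr p"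
      using s p by (simp add: \<kappa>_def powr_divide powr_minus field_simps)
    also have "ennreal (l / 2 * 2 powr p) \<le> ennreal l"
      using powr_mono[of p 1 "2::real"] p assms by (intro ennreal_leI) simp
    finally show ?thesis
      by (simp add: ennreal_minus_le_iff add.commute)
  qed
  have "(\<integral>\<^sup>+s\<in>{0<..}. ennreal (1 / s) * (ennreal (s powr p) * dist_fun M pointwise_sum s - ennreal l) \<partial>lborel)
    \<le> (\<integral>\<^sup>+s\<in>{0<..}. ennreal (s powr (p - 1)) * dist_fun M ?G1 s \<partial>lborel)"
  proof (rule nn_integral_mono)
    fix s
    show "ennreal (1 / s) * (ennreal (s powr p) * dist_fun M pointwise_sum s - ennreal l) * indicator {0<..} s
      \<le> ennreal (s powr (p - 1)) * dist_fun M ?G1 s * indicator {0<..} s"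
    proof (cases "0 < s")
      case True
      show ?thesis
        using mult_left_mono[OF excess[OF True], of "ennreal (1 / s)"] True
        by (simp add: mult.assoc[symmetric] weight)
    qed simp
  qed
  also note nn_integral_dist_large_part_le[OF \<kappa>]
  also have "(\<integral>\<^sup>+s\<in>{0<..}. ennreal (s powr (p - 1)) * dist_sum s *
        indicator {s. ennreal (\<kappa> / 4) < ennreal (s powr p) * dist_sum s} s \<partial>lborel)
    = (\<integral>\<^sup>+s\<in>{0<..}. ennreal (1 / s) * (ennreal (s powr p) * dist_sum s) *
        indicator {s. ennreal l < ennreal (8 / (1 - p)) * (ennreal (s powr p) * dist_sum s)} s \<partial>lborel)"
  proof (rule nn_integral_cong)
    fix s
    have "ennreal l = ennreal (8 / (1 - p)) * ennreal (\<kappa> / 4)"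
      using p \<kappa> by (simp add: \<kappa>_def flip: ennreal_mult)
    then have "ennreal l < ennreal (8 / (1 - p)) * y \<longleftrightarrow> ennreal (\<kappa> / 4) < y" for y
      using p by (simp add: not_le[symmetric] ennreal_mult_le_mult_iff)
    then show "ennreal (s powr (p - 1)) * dist_sum s *
        indicator {s. ennreal (\<kappa> / 4) < ennreal (s powr p) * dist_sum s} s * indicator {0<..} s
      = ennreal (1 / s) * (ennreal (s powr p) * dist_sum s) *
        indicator {s. ennreal l < ennreal (8 / (1 - p)) * (ennreal (s powr p) * dist_sum s)} s * indicator {0<..} s"
      by (cases "0 < s") (simp_all add: weight[symmetric] mult.assoc)
  qed
  finally show ?thesis .
qed

end

section \<open>Integration of the excess estimate over all levels\<close>

lemma le_double_minus:
  fixes a :: ennreal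
  assumes "l < a"
  shows "a \<le> (a + a) - l"
proof (cases "a = top")
  case True
  with assms show ?thesis by simp
next
  case False
  then have "a = (a + a) - a" by simp
  also have "\<dots> \<le> (a + a) - l"
    using assms by (intro ennreal_minus_mono) auto
  finally show ?thesis .
qed

text \<open>For levels below h/2 the excess is at least h/2, and these levels have d(l^(q-1))-mass
  (h/2)^(q-1). The resulting 2^q is crude but is absorbed by the constant A^(1/p), and an infinite h
  needs no separate argument.\<close>

lemma ennpowr_le_nn_integral_excess:
  assumes "1 < q"
  shows "ennpowr h q \<le> ennreal (2 powr q) *
    (\<integral>\<^sup>+l\<in>{0<..}. ennreal ((q - 1) * l powr (q - 2)) * (h - ennreal l) \<partial>lborel)"
proof -
  let ?h2 = "h * ennreal (1 / 2)"
  have half: "h = ?h2 + ?h2"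
    by (simp only: distrib_left[symmetric] ennreal_plus[of "1/2" "1/2", symmetric]) simp
  have double: "ennpowr h q = ennreal (2 powr q) * ennpowr ?h2 q"
  proof -
    have "ennreal (2 powr q) * ennpowr (ennreal (1 / 2)) q = 1"
      by (subst ennpowr_ennreal) (simp_all add: powr_divide flip: ennreal_mult)
    moreover have "ennpowr ?h2 q = ennpowr h q * ennpowr (ennreal (1 / 2)) q"
      using assms by (intro ennpowr_mult) simp
    ultimately show ?thesis
      by (metis mult.left_commute mult_1_right)
  qed
  have "ennpowr ?h2 q = ennpowr ?h2 (q - 1) * ?h2"
    using ennpowr_add[of ?h2 "q - 1" 1] by simp
  also have "\<dots> = (\<integral>\<^sup>+l\<in>{0<..}. ennreal ((q - 1) * l powr (q - 2)) * indicator {l. ennreal l < ?h2} l \<partial>lborel) * ?h2"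
    using nn_integral_power_weight[of "q - 1" ?h2] assms by simp
  also have "\<dots> = (\<integral>\<^sup>+l. ennreal ((q - 1) * l powr (q - 2)) * indicator {l. ennreal l < ?h2} l * indicator {0<..} l * ?h2 \<partial>lborel)"
    by (rule nn_integral_multc[symmetric]) measurable
  also have "\<dots> \<le> (\<integral>\<^sup>+l\<in>{0<..}. ennreal ((q - 1) * l powr (q - 2)) * (h - ennreal l) \<partial>lborel)"
  proof (rule nn_integral_mono)
    fix l
    have "?h2 \<le> h - ennreal l" if "ennreal l < ?h2"
      using le_double_minus[OF that] unfolding half[symmetric] .
    then show "ennreal ((q - 1) * l powr (q - 2)) * indicator {l. ennreal l < ?h2} l * indicator {0<..} l * ?h2
      \<le> ennreal ((q - 1) * l powr (q - 2)) * (h - ennreal l) * indicator {0<..} l"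
      by (auto simp: indicator_def intro!: mult_left_mono)
  qed
  finally show ?thesis
    unfolding double by (rule mult_left_mono) simp
qed

context nonneg_series
begin

text \<open>The comparison of h with g holds only after integration in s at a fixed level, so
  Tonelli is used twice: to bring the s-integral inside, and to return to an l-integral for each
  fixed s.\<close>

lemma lorentz_integral_sum_le:
  assumes "1 < q"
  shows "lorentz_integral p q (dist_fun M pointwise_sum)
    \<le> ennreal (16 powr q * (1 / (1 - p)) powr (q - 1)) * lorentz_integral p q dist_sum"
proof -
  define g where "g s = ennreal (s powr p) * dist_sum s" for s
  define h where "h s = ennreal (s powr p) * dist_fun M pointwise_sum s" for s
  define W where "W l = ennreal ((q - 1) * l powr (q - 2)) * indicator {0<..} l" for l :: real
  define w where "w s = ennreal (1 / s) * indicator {0<..} s" for s :: real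
  define K where "K = 8 / (1 - p)"
  have K: "0 < K" using p by (simp add: K_def)
  have [measurable]: "g \<in> borel_measurable borel" "h \<in> borel_measurable borel"
      "W \<in> borel_measurable borel" "w \<in> borel_measurable borel"
    unfolding g_def h_def W_def w_def by measurable
  have eq: "lorentz_integral p q D = (\<integral>\<^sup>+s. w s * ennpowr (ennreal (s powr p) * D s) q \<partial>lborel)" for D
    unfolding lorentz_integral_def w_def
  proof (rule nn_integral_cong)
    fix s
    show "ennreal (s powr (p * q - 1)) * ennpowr (D s) q * indicator {0<..} s
      = ennreal (1 / s) * indicator {0<..} s * ennpowr (ennreal (s powr p) * D s) q"
    proof (cases "0 < s")
      case True
      then have "ennreal (1 / s) * ennreal (s powr (p * q)) = ennreal (s powr (p * q - 1))"
        by (simp add: powr_diff flip: ennreal_mult)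
      with True show ?thesis
        using assms by (simp add: ennpowr_mult ennpowr_ennreal powr_powr mult.assoc[symmetric])
    qed simp
  qed
  have "lorentz_integral p q (dist_fun M pointwise_sum) = (\<integral>\<^sup>+s. w s * ennpowr (h s) q \<partial>lborel)"
    unfolding eq h_def ..
  also have "\<dots> \<le> (\<integral>\<^sup>+s. w s * (ennreal (2 powr q) * (\<integral>\<^sup>+l. W l * (h s - ennreal l) \<partial>lborel)) \<partial>lborel)"
  proof (intro nn_integral_mono mult_left_mono)
    fix s
    have "(\<integral>\<^sup>+l. W l * (h s - ennreal l) \<partial>lborel)
        = (\<integral>\<^sup>+l\<in>{0<..}. ennreal ((q - 1) * l powr (q - 2)) * (h s - ennreal l) \<partial>lborel)"
      by (intro nn_integral_cong) (simp add: W_def mult_ac)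
    then show "ennpowr (h s) q \<le> ennreal (2 powr q) * (\<integral>\<^sup>+l. W l * (h s - ennreal l) \<partial>lborel)"
      using ennpowr_le_nn_integral_excess[OF assms, of "h s"] by simp
  qed simp
  also have "\<dots> = ennreal (2 powr q) * (\<integral>\<^sup>+s. (\<integral>\<^sup>+l. W l * (w s * (h s - ennreal l)) \<partial>lborel) \<partial>lborel)"
    by (subst nn_integral_cmult[symmetric], measurable)
      (auto intro!: nn_integral_cong simp: nn_integral_cmult[symmetric] mult_ac)
  also have "(\<integral>\<^sup>+s. (\<integral>\<^sup>+l. W l * (w s * (h s - ennreal l)) \<partial>lborel) \<partial>lborel)
      = (\<integral>\<^sup>+l. (\<integral>\<^sup>+s. W l * (w s * (h s - ennreal l)) \<partial>lborel) \<partial>lborel)"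
    by (rule lborel_pair.Fubini') measurable
  also have "\<dots> \<le> (\<integral>\<^sup>+l. (\<integral>\<^sup>+s. W l * (8 * (w s * g s * indicator {s. ennreal l < ennreal K * g s} s)) \<partial>lborel) \<partial>lborel)"
  proof (rule nn_integral_mono)
    fix l
    show "(\<integral>\<^sup>+s. W l * (w s * (h s - ennreal l)) \<partial>lborel)
      \<le> (\<integral>\<^sup>+s. W l * (8 * (w s * g s * indicator {s. ennreal l < ennreal K * g s} s)) \<partial>lborel)"
    proof (cases "0 < l")
      case True
      have "(\<integral>\<^sup>+s. w s * (h s - ennreal l) \<partial>lborel)
          \<le> 8 * (\<integral>\<^sup>+s. w s * g s * indicator {s. ennreal l < ennreal K * g s} s \<partial>lborel)"
        using nn_integral_excess_le[OF True] by (simp add: w_def h_def g_def K_def mult_ac)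
      then show ?thesis
        by (simp add: nn_integral_cmult mult_left_mono)
    qed (simp add: W_def)
  qed
  also have "\<dots> = (\<integral>\<^sup>+s. (\<integral>\<^sup>+l. W l * (8 * (w s * g s * indicator {s. ennreal l < ennreal K * g s} s)) \<partial>lborel) \<partial>lborel)"
    by (rule lborel_pair.Fubini') measurable
  \<comment> \<open>Only the upper limit K g of the l-integral contains K; the factor g in front is
    unscaled, whence K^(q-1) g^q.\<close>
  also have "\<dots> = (\<integral>\<^sup>+s. 8 * (w s * g s) * ennpowr (ennreal K * g s) (q - 1) \<partial>lborel)"
  proof (rule nn_integral_cong)
    fix s
    have "(\<integral>\<^sup>+l. W l * (8 * (w s * g s * indicator {s. ennreal l < ennreal K * g s} s)) \<partial>lborel)
      = (\<integral>\<^sup>+l. 8 * (w s * g s) * (W l * indicator {l. ennreal l < ennreal K * g s} l) \<partial>lborel)"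
      by (intro nn_integral_cong) (simp add: indicator_def mult_ac)
    also have "\<dots> = 8 * (w s * g s) * (\<integral>\<^sup>+l. W l * indicator {l. ennreal l < ennreal K * g s} l \<partial>lborel)"
      by (rule nn_integral_cmult) measurable
    also have "(\<integral>\<^sup>+l. W l * indicator {l. ennreal l < ennreal K * g s} l \<partial>lborel) = ennpowr (ennreal K * g s) (q - 1)"
      using nn_integral_power_weight[of "q - 1" "ennreal K * g s"] assms by (simp add: W_def mult_ac)
    finally show "(\<integral>\<^sup>+l. W l * (8 * (w s * g s * indicator {s. ennreal l < ennreal K * g s} s)) \<partial>lborel)
      = 8 * (w s * g s) * ennpowr (ennreal K * g s) (q - 1)" .
  qed
  also have "\<dots> = (\<integral>\<^sup>+s. ennreal (8 * K powr (q - 1)) * (w s * ennpowr (g s) q) \<partial>lborel)"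
  proof (rule nn_integral_cong)
    fix s
    have "ennpowr (g s) q = g s * ennpowr (g s) (q - 1)"
      using ennpowr_add[of "g s" 1 "q - 1"] by simp
    then show "8 * (w s * g s) * ennpowr (ennreal K * g s) (q - 1)
      = ennreal (8 * K powr (q - 1)) * (w s * ennpowr (g s) q)"
      using assms K by (simp add: ennpowr_mult ennpowr_ennreal ennreal_mult mult_ac)
  qed
  also have "\<dots> = ennreal (8 * K powr (q - 1)) * lorentz_integral p q dist_sum"
    unfolding eq g_def[symmetric] by (rule nn_integral_cmult) measurable
  finally have "lorentz_integral p q (dist_fun M pointwise_sum)
    \<le> ennreal (2 powr q) * (ennreal (8 * K powr (q - 1)) * lorentz_integral p q dist_sum)"
    by (simp add: mult_left_mono)
  also have "\<dots> = ennreal (2 powr q * (8 * K powr (q - 1))) * lorentz_integral p q dist_sum"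
    by (simp add: ennreal_mult mult_ac)
  also have "2 powr q * (8 * K powr (q - 1)) = 16 powr q * (1 / (1 - p)) powr (q - 1)"
  proof -
    have K_powr: "K powr (q - 1) = 8 powr (q - 1) * (1 / (1 - p)) powr (q - 1)"
      using p by (simp add: K_def powr_divide)
    have "2 powr q * (8 * K powr (q - 1)) = (2 powr q * (8 * 8 powr (q - 1))) * (1 / (1 - p)) powr (q - 1)"
      unfolding K_powr by (simp only: mult.assoc)
    also have "8 * 8 powr (q - 1) = (8::real) powr q"
      by (simp add: powr_diff)
    also have "2 powr q * 8 powr q = (16::real) powr q"
      by (simp flip: powr_mult)
    finally show ?thesis .
  qed
  finally show ?thesis .
qed

end

text \<open>Restricting \<open>M\<close> to the set where some \<open>v k\<close> is nonzero makes it \<open>\<sigma>\<close>-finite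
  without changing any of the distribution functions.\<close>

lemma lorentz_integral_suminf_dist_fun_le:
  fixes v :: "nat \<Rightarrow> 'a \<Rightarrow> real"
  assumes [measurable]: "\<And>k. v k \<in> borel_measurable M"
    and nonneg: "\<And>k x. 0 \<le> v k x"
    and fin: "\<And>k s. 0 < s \<Longrightarrow> dist_fun M (\<lambda>x. ennreal (v k x)) s < top"
    and "0 < p" "p < 1" "1 < q"
  shows "lorentz_integral p q (dist_fun M (\<lambda>x. \<Sum>k. ennreal (v k x)))
    \<le> ennreal (16 powr q * (1 / (1 - p)) powr (q - 1)) *
       lorentz_integral p q (\<lambda>s. \<Sum>k. dist_fun M (\<lambda>x. ennreal (v k x)) s)"
proof -
  define Z where "Z = {x \<in> space M. \<exists>k. 0 < v k x}"
  have [measurable]: "Z \<in> sets M" unfolding Z_def by measurable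
  define M' where "M' = density M (indicator Z)"
  have [measurable_cong]: "sets M' = sets M" and space: "space M' = space M"
    by (simp_all add: M'_def)
  have emeasure: "emeasure M' A = emeasure M (Z \<inter> A)" if "A \<in> sets M" for A
    unfolding M'_def by (rule emeasure_restricted) (use that in measurable)
  have dist: "dist_fun M' u s = dist_fun M u s"
    if [measurable]: "u \<in> borel_measurable M" and "\<And>x. x \<in> space M - Z \<Longrightarrow> u x = 0" for u s
  proof -
    have "Z \<inter> {x \<in> space M. ennreal s < u x} = {x \<in> space M. ennreal s < u x}"
      using that(2) by force
    then show ?thesis
      by (simp add: dist_fun_def space emeasure)
  qed
  have zero: "v k x = 0" if "x \<in> space M - Z" for k x
    using that nonneg[of k x] by (auto simp: Z_def not_less intro: antisym)
  \<comment> \<open>These sets cover \<open>Z\<close> and have finite measure by \<open>fin\<close>,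
    since their levels are positive; the complement of \<open>Z\<close> has
    \<open>M'\<close>-measure 0 and completes the countable cover.\<close>
  define B where "B = (\<lambda>(k, n). {x \<in> space M. ennreal (1 / real (Suc n)) < ennreal (v k x)})"
  have "sigma_finite_measure M'"
  proof
    show "\<exists>A. countable A \<and> A \<subseteq> sets M' \<and> \<Union> A = space M' \<and> (\<forall>a\<in>A. emeasure M' a \<noteq> \<infinity>)"
    proof (intro exI[of _ "insert (space M - Z) (range B)"] conjI ballI)
      show "insert (space M - Z) (range B) \<subseteq> sets M'"
        unfolding B_def by (auto simp: split_beta)
      show "\<Union> (insert (space M - Z) (range B)) = space M'"
      proof (intro equalityI subsetI)
        fix x assume "x \<in> space M'"
        then have x: "x \<in> space M" by (simp add: space)
        show "x \<in> \<Union> (insert (space M - Z) (range B))"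
        proof (cases "x \<in> Z")
          case True
          then obtain k where "0 < v k x" by (auto simp: Z_def)
          then obtain n where "1 / real (Suc n) < v k x"
            using nat_approx_posE by metis
          then have "x \<in> B (k, n)"
            using x by (simp add: B_def ennreal_less_iff)
          then show ?thesis by blast
        qed (use x in auto)
      qed (auto simp: B_def space)
      fix a assume "a \<in> insert (space M - Z) (range B)"
      then consider "a = space M - Z" | k n where "a = B (k, n)" by auto
      then show "emeasure M' a \<noteq> \<infinity>"
      proof cases
        case 1
        then show ?thesis by (simp add: emeasure)
      next
        case 2
        have "emeasure M' a = dist_fun M' (\<lambda>x. ennreal (v k x)) (1 / real (Suc n))"
          by (simp add: 2 B_def dist_fun_def space)
        also have "\<dots> = dist_fun M (\<lambda>x. ennreal (v k x)) (1 / real (Suc n))"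
          using zero by (intro dist) auto
        also have "\<dots> < top"
          by (intro fin) simp
        finally show ?thesis by simp
      qed
    qed auto
  qed
  then interpret nonneg_series M' v p
    using assms by (intro nonneg_series.intro nonneg_series_axioms.intro) auto
  have "dist_sum = (\<lambda>s. \<Sum>k. dist_fun M (\<lambda>x. ennreal (v k x)) s)"
    unfolding dist_sum_def using zero by (intro ext suminf_cong dist) auto
  moreover have "dist_fun M' pointwise_sum = dist_fun M (\<lambda>x. \<Sum>k. ennreal (v k x))"
    unfolding pointwise_sum_def using zero by (intro ext dist) auto
  ultimately show ?thesis
    using lorentz_integral_sum_le[OF \<open>1 < q\<close>] by simp
qed

text \<open>The integral of s^(pq-1) diverges at infinity. Applied with m the measure of the set
  where the sum of the moduli is infinite, this forces that set to be null.\<close>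

lemma lorentz_integral_top:
  assumes "0 < p" "0 < q" "0 < m" "\<And>s. m \<le> D s"
  shows "lorentz_integral p q D = top"
proof -
  define a where "a = p * q"
  have a: "0 < a" using assms by (simp add: a_def)
  have "ennreal a * (\<integral>\<^sup>+s\<in>{0<..}. ennreal (s powr (a - 1)) \<partial>lborel)
      = (\<integral>\<^sup>+s\<in>{0<..}. ennreal (a * s powr (a - 1)) * indicator {s. ennreal s < top} s \<partial>lborel)"
    using a by (subst nn_integral_cmult[symmetric]) (auto intro!: nn_integral_cong simp: ennreal_mult mult_ac)
  also have "\<dots> = top"
    using nn_integral_power_weight[OF a, of top] by simp
  finally have "(\<integral>\<^sup>+s\<in>{0<..}. ennreal (s powr (p * q - 1)) \<partial>lborel) = top"
    by (auto simp: ennreal_mult_eq_top_iff a_def)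
  moreover have "ennpowr m q \<noteq> 0"
    using assms by (auto simp: ennpowr_def enn2real_eq_0_iff)
  ultimately have "top = ennpowr m q * (\<integral>\<^sup>+s\<in>{0<..}. ennreal (s powr (p * q - 1)) \<partial>lborel)"
    by (simp add: ennreal_mult_top)
  also have "\<dots> = (\<integral>\<^sup>+s. ennpowr m q * (ennreal (s powr (p * q - 1)) * indicator {0<..} s) \<partial>lborel)"
    by (rule nn_integral_cmult[symmetric]) measurable
  also have "\<dots> \<le> lorentz_integral p q D"
    unfolding lorentz_integral_def using assms
    by (intro nn_integral_mono) (auto simp: indicator_def mult.commute intro!: mult_right_mono ennpowr_mono)
  finally show ?thesis by (simp add: top_unique)
qed

text \<open>An infinite value at s persists on (0,s) by monotonicity and makes the integral
  infinite. Finiteness at every positive level is what the reduction to a sigma-finite measure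
  requires.\<close>

lemma dist_fun_finite:
  assumes "lorentz_integral p q (dist_fun M u) < top" "0 < p" "0 < q" "0 < s"
    and [measurable]: "u \<in> borel_measurable M"
  shows "dist_fun M u s < top"
proof (rule ccontr)
  assume "\<not> ?thesis"
  then have "dist_fun M u s = top" by (simp add: less_top[symmetric])
  then have top: "dist_fun M u t = top" if "t < s" for t
    using antimonoD[OF antimono_dist_fun[of u M], of t s] that by (simp add: top_unique)
  have "(\<integral>\<^sup>+t. top * indicator {0<..<s} t \<partial>lborel) \<le> lorentz_integral p q (dist_fun M u)"
    unfolding lorentz_integral_def using top
    by (intro nn_integral_mono) (auto simp: indicator_def ennreal_mult_top)
  moreover have "(\<integral>\<^sup>+t. top * indicator {0<..<s} t \<partial>lborel) = top"
    using assms by (subst nn_integral_cmult_indicator) (auto simp: ennreal_top_mult)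
  ultimately show False using assms(1) by (simp add: top_unique)
qed

section \<open>The Lorentz quasi-norm of a sum\<close>

lemma lorentz_norm_finite_dist_fun:
  assumes "f \<in> lorentz_space M p r" "0 < p" "0 < r" "0 < s"
  shows "dist_fun M (\<lambda>x. ennreal (norm (f x))) s < top"
proof (rule dist_fun_finite)
  have [measurable]: "f \<in> borel_measurable M" and fin: "lorentz_norm M p r f < top"
    using assms(1) by (auto simp: lorentz_space_def)
  show "(\<lambda>x. ennreal (norm (f x))) \<in> borel_measurable M" by measurable
  have "ennreal r * lorentz_integral p (r / p) (dist_fun M (\<lambda>x. ennreal (norm (f x)))) \<noteq> top"
    using fin assms by (auto simp: lorentz_norm_eq less_top[symmetric])
  then show "lorentz_integral p (r / p) (dist_fun M (\<lambda>x. ennreal (norm (f x)))) < top"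
    using assms by (auto simp: ennreal_mult_eq_top_iff less_top[symmetric])
qed (use assms in auto)

text \<open>For a series that is not absolutely summable the left-hand side may be a junk value, but then
  the right-hand side is infinite.\<close>

lemma norm_suminf_le_suminf_ennreal_norm:
  fixes f :: "nat \<Rightarrow> 'a :: banach"
  shows "ennreal (norm (\<Sum>k. f k)) \<le> (\<Sum>k. ennreal (norm (f k)))"
proof (cases "(\<Sum>k. ennreal (norm (f k))) = top")
  case False
  then have "summable (\<lambda>k. norm (f k))"
    by (intro summable_suminf_not_top) auto
  then show ?thesis
    by (subst suminf_ennreal2) (auto intro!: ennreal_leI summable_norm)
qed simp

text \<open>Bounding the sum of the moduli, rather than the modulus of the sum, yields almost
  everywhere convergence of the series from the same estimate.\<close>

lemma lorentz_quasinorm_suminf_norm_le: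
  fixes f :: "nat \<Rightarrow> 'a \<Rightarrow> complex"
  assumes p: "0 < p" "p < 1" "p < r" and f: "\<And>k. f k \<in> lorentz_space M p r"
  shows "ennpowr (ennreal r * lorentz_integral p (r / p) (dist_fun M (\<lambda>x. \<Sum>k. ennreal (norm (f k x))))) (1 / r)
    \<le> ennreal (16 powr (1 / p) * (1 / (1 - p)) powr (1 / p - 1 / r)) *
       ennpowr (\<Sum>k. ennpowr (lorentz_norm M p r (f k)) p) (1 / p)"
proof -
  define q where "q = r / p"
  define D where "D k = dist_fun M (\<lambda>x. ennreal (norm (f k x)))" for k
  define G where "G x = (\<Sum>k. ennreal (norm (f k x)))" for x
  define T where "T = (\<Sum>k. ennpowr (lorentz_norm M p r (f k)) p)"
  let ?I = "lorentz_integral p q"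
  define N where "N = ennreal r * ?I (\<lambda>s. \<Sum>k. D k s)"
  have q: "1 < q" "0 < q" and r: "0 < r" using p by (auto simp: q_def)
  have [measurable]: "f k \<in> borel_measurable M" for k
    using f[of k] by (simp add: lorentz_space_def)
  have [measurable]: "D k \<in> borel_measurable borel" for k
    unfolding D_def by measurable
  \<comment> \<open>Since p/r = 1/q, the p-th power of the quasi-norm is an L^q norm. The factor
    r^(1/q) is common to all terms and is recovered in \<open>N\<close>.\<close>
  have norm_p: "ennpowr (lorentz_norm M p r (f k)) p = ennpowr (ennreal r) (1 / q) * ennpowr (?I (D k)) (1 / q)" for k
    using p r q by (simp add: lorentz_norm_eq D_def ennpowr_ennpowr ennpowr_mult[symmetric]) (simp add: q_def)
  have "ennpowr N (1 / q) = ennpowr (ennreal r) (1 / q) * ennpowr (?I (\<lambda>s. \<Sum>k. D k s)) (1 / q)"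
    using q by (simp add: N_def ennpowr_mult)
  also have "\<dots> \<le> ennpowr (ennreal r) (1 / q) * (\<Sum>k. ennpowr (?I (D k)) (1 / q))"
    using q by (intro mult_left_mono lorentz_integral_suminf_le) auto
  also have "\<dots> = T"
    by (simp add: T_def norm_p)
  finally have "ennpowr (ennpowr N (1 / q)) (1 / p) \<le> ennpowr T (1 / p)"
    using p by (intro ennpowr_mono) auto
  then have N: "ennpowr N (1 / r) \<le> ennpowr T (1 / p)"
    using p by (simp add: ennpowr_ennpowr q_def)
  have "ennreal r * ?I (dist_fun M G)
      \<le> ennreal r * (ennreal (16 powr q * (1 / (1 - p)) powr (q - 1)) * ?I (\<lambda>s. \<Sum>k. D k s))"
    unfolding G_def D_def using p q r lorentz_norm_finite_dist_fun[OF f]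
    by (intro mult_left_mono lorentz_integral_suminf_dist_fun_le) auto
  also have "\<dots> = ennreal (16 powr q * (1 / (1 - p)) powr (q - 1)) * N"
    by (simp add: N_def mult_ac)
  finally have "ennpowr (ennreal r * ?I (dist_fun M G)) (1 / r)
      \<le> ennpowr (ennreal (16 powr q * (1 / (1 - p)) powr (q - 1)) * N) (1 / r)"
    using r by (intro ennpowr_mono) auto
  also have "\<dots> = ennreal ((16 powr q * (1 / (1 - p)) powr (q - 1)) powr (1 / r)) * ennpowr N (1 / r)"
    using r by (simp add: ennpowr_mult ennpowr_ennreal)
  also have "(16 powr q * (1 / (1 - p)) powr (q - 1)) powr (1 / r)
      = 16 powr (1 / p) * (1 / (1 - p)) powr (1 / p - 1 / r)"
  proof -
    have "q * (1 / r) = 1 / p" "(q - 1) * (1 / r) = 1 / p - 1 / r"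
      using p r by (auto simp: q_def field_simps)
    then show ?thesis
      using p by (simp only: powr_mult powr_powr)
  qed
  also have "ennreal \<dots> * ennpowr N (1 / r) \<le> ennreal \<dots> * ennpowr T (1 / p)"
    by (intro mult_left_mono N) simp
  finally show ?thesis
    by (simp add: G_def T_def q_def)
qed

theorem propositionB1:
  shows "\<exists>(A::real) (C :: real \<Rightarrow> real \<Rightarrow> real). 0 < A \<and>
    (\<forall>p r :: real. 0 < p \<and> p < 1 \<and> p < r \<longrightarrow>
       C p r \<le> A powr (1 / p) * (1 / (1 - p)) powr (1 / p - 1 / r)
                 * (1 + p / r * ln (1 / (1 - p))) powr (1 / p - 1 / r) \<and>
       (\<forall>(M :: 'a measure) (f :: nat \<Rightarrow> 'a \<Rightarrow> complex).
          nonatomic M \<and> (\<forall>k. f k \<in> lorentz_space M p r) \<longrightarrow>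
            ((\<Sum>k. ennpowr (lorentz_norm M p r (f k)) p) < \<infinity> \<longrightarrow>
               (AE x in M. summable (\<lambda>k. f k x))) \<and>
            lorentz_norm M p r (\<lambda>x. \<Sum>k. f k x)
              \<le> ennreal (C p r) * ennpowr (\<Sum>k. ennpowr (lorentz_norm M p r (f k)) p) (1 / p)))"
proof (intro exI[of _ 16] exI[of _ "\<lambda>p r. 16 powr (1 / p) * (1 / (1 - p)) powr (1 / p - 1 / r)"] conjI allI impI;
    (elim conjE)?)
  fix p r :: real
  assume p: "0 < p" "p < 1" "p < r"
  then have r: "0 < r" by simp
  \<comment> \<open>The logarithmic factor is at least 1, because its base is at least 1 and its
    exponent 1/p - 1/r is nonnegative; the constant without it is therefore admissible.\<close>
  have "0 \<le> ln (1 / (1 - p))"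
    using p by (intro ln_ge_zero) simp
  then have "1 \<le> (1 + p / r * ln (1 / (1 - p))) powr (1 / p - 1 / r)"
    using p r by (intro ge_one_powr_ge_zero) (auto simp: field_simps)
  from mult_left_mono[OF this, of "16 powr (1 / p) * (1 / (1 - p)) powr (1 / p - 1 / r)"]
  show "16 powr (1 / p) * (1 / (1 - p)) powr (1 / p - 1 / r)
      \<le> 16 powr (1 / p) * (1 / (1 - p)) powr (1 / p - 1 / r) * (1 + p / r * ln (1 / (1 - p))) powr (1 / p - 1 / r)"
    by simp
  fix M :: "'a measure" and f :: "nat \<Rightarrow> 'a \<Rightarrow> complex"
  assume "\<forall>k. f k \<in> lorentz_space M p r"
  then have f: "f k \<in> lorentz_space M p r" for k by simp
  then have [measurable]: "f k \<in> borel_measurable M" for k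
    by (simp add: lorentz_space_def)
  define G where "G x = (\<Sum>k. ennreal (norm (f k x)))" for x
  have [measurable]: "G \<in> borel_measurable M"
    unfolding G_def by measurable
  have bound: "ennpowr (ennreal r * lorentz_integral p (r / p) (dist_fun M G)) (1 / r)
      \<le> ennreal (16 powr (1 / p) * (1 / (1 - p)) powr (1 / p - 1 / r)) *
         ennpowr (\<Sum>k. ennpowr (lorentz_norm M p r (f k)) p) (1 / p)"
    unfolding G_def by (rule lorentz_quasinorm_suminf_norm_le[OF p f])
  have dist_le: "dist_fun M (\<lambda>x. ennreal (norm (\<Sum>k. f k x))) s \<le> dist_fun M G s" for s
    by (intro dist_fun_mono) (simp_all add: G_def norm_suminf_le_suminf_ennreal_norm)
  have "lorentz_norm M p r (\<lambda>x. \<Sum>k. f k x)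
      = ennpowr (ennreal r * lorentz_integral p (r / p) (dist_fun M (\<lambda>x. ennreal (norm (\<Sum>k. f k x))))) (1 / r)"
    using p r by (intro lorentz_norm_eq) auto
  also have "\<dots> \<le> ennpowr (ennreal r * lorentz_integral p (r / p) (dist_fun M G)) (1 / r)"
    using p r dist_le by (intro ennpowr_mono mult_left_mono lorentz_integral_mono) auto
  also note bound
  finally show "lorentz_norm M p r (\<lambda>x. \<Sum>k. f k x)
      \<le> ennreal (16 powr (1 / p) * (1 / (1 - p)) powr (1 / p - 1 / r)) *
         ennpowr (\<Sum>k. ennpowr (lorentz_norm M p r (f k)) p) (1 / p)" .
  assume "(\<Sum>k. ennpowr (lorentz_norm M p r (f k)) p) < \<infinity>"
  then have "ennreal (16 powr (1 / p) * (1 / (1 - p)) powr (1 / p - 1 / r)) *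
         ennpowr (\<Sum>k. ennpowr (lorentz_norm M p r (f k)) p) (1 / p) < top"
    by (auto simp: ennreal_mult_eq_top_iff less_top[symmetric])
  with bound have "ennpowr (ennreal r * lorentz_integral p (r / p) (dist_fun M G)) (1 / r) < top"
    by (rule le_less_trans)
  then have "lorentz_integral p (r / p) (dist_fun M G) \<noteq> top"
    using r by (auto simp: ennreal_mult_top)
  \<comment> \<open>Points with \<open>G x = top\<close> are counted at every level, so their
    measure is a constant lower bound for the distribution function of \<open>G\<close>.\<close>
  moreover have "emeasure M {x \<in> space M. G x = top} \<le> dist_fun M G s" for s
    unfolding dist_fun_def by (intro emeasure_mono) auto
  ultimately have "\<not> 0 < emeasure M {x \<in> space M. G x = top}"
    using lorentz_integral_top[of p "r / p" "emeasure M {x \<in> space M. G x = top}" "dist_fun M G"] p r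
    by (metis divide_pos_pos)
  then have "emeasure M {x \<in> space M. G x = top} = 0"
    by (simp only: zero_less_iff_neq_zero not_not)
  then have "AE x in M. G x \<noteq> top"
    by (intro AE_I[where N="{x \<in> space M. G x = top}"]) auto
  then show "AE x in M. summable (\<lambda>k. f k x)"
    by eventually_elim (auto simp: G_def intro!: summable_norm_cancel[of "\<lambda>k. f k _"] summable_suminf_not_top)
qed simp

end
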